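(* Let $\mathbb{F}_3$ be the field with three elements and let $P_1,\dots,P_{40}$ be a fixed ordering of the $40$ points of the projective space $PG(3,3)$. Let $C_3$ be the linear code over $\mathbb{F}_3$ of length $40$ and dimension $10$ generated by the $10\times 40$ matrix whose $j$-th column is a vector in $\mathbb{F}_3^{10}$ representing the point $\iota(P_j)$, where $\iota(x_0,x_1,x_2,x_3)=(x_0^2,x_0x_1,x_1^2,x_0x_2,x_1x_2,x_2^2,x_0x_3,x_1x_3,x_2x_3,x_3^2)$ is the quadratic Veronese embedding. For $1\le r\le 10$ let $W^{(r)}(Z)=\sum_{D} Z^{|\mathrm{supp}(D)|}$, the sum over all $r$-dimensional $\mathbb{F}_3$-linear subspaces $D$ of $C_3$, where $\mathrm{supp}(D)$ is the set of coordinates at which some codeword of $D$ is nonzero. Then \begin{align*} W^{(1)}(Z)=&2 Z^{18}(195 Z^{18} + 4212 Z^{12} + 4700 Z^9 + 5265 Z^6 + 390),\\ W^{(2)}(Z) =& 13 Z^{24}(67797 Z^{16} + 243000 Z^{15} + 597780 Z^{14} + 933120 Z^{13}+ 1151610 Z^{12} + 991440 Z^{11}\\ &+ 816480 Z^{10} + 428400 Z^9 + 182250 Z^8 + 116640 Z^7 + 43200 Z^6 + 14580 Z^4 + 760 Z^3 + 360),\\ W^{(3)}(Z)=&10Z^{26} (408114369 Z^{14} + 615347208 Z^{13} + 471425994 Z^{12} + 230935536 Z^{11} + 79511991 Z^{10}\\ & + 20839572 Z^9 + 5231304 Z^8 + 968760 Z^7 + 237978 Z^6 + 50544 Z^5 +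 9360 Z^4 + 52 Z + 108),\\ W^{(4)}(Z)=& Z^{27}( 304888261329 Z^{13} + 152054622720 Z^{12} + 37402159860 Z^{11} + 5713746480 Z^{10} \\ &+ 641358900 Z^9 + 69893928 Z^8 + 7076160 Z^7 + 627120 Z^6 + 89505 Z^5 + 40),\\ W^{(5)}(Z)=& 26 Z^{33}( 49159423665 Z^7 + 8099569140 Z^6 + 649260360 Z^5 + 31541400 Z^4 \\ &+ 1366565 Z^3 + 73548 Z^2 + 2430 Z + 120),\\ W^{(6)}(Z)=& 2 Z^{35}(237163797936 Z^5 + 12886036860 Z^4 + 334019790 Z^3 + 4956120 Z^2 + 104975 Z + 2340),\\ W^{(7)}(Z)= &10 Z^{36}(1800649161 Z^4 + 31769712 Z^3 + 252954 Z^2 + 936 Z + 13),\\ W^{(8)}(Z)= &13 Z^{38} (5557197 Z^2 + 30160 Z + 60),\\ W^{(9)}(Z)=&4 Z^{39}(7371 Z + 10),\\ W^{(10)}(Z) =& Z^{40}. \end{align*} In particular, the generalized Hamming weights $d_r=\min\{|\mathrm{supp}(D)| : D\subseteq C_3,\ \dim D=r\}$ of $C_3$ are $d_1=18, d_2=24, d_3=26, d_4=27, d_5=33, d_6=35, d_7=36, d_8=38, d_9=39, d_{10}=40$.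
   Context: The polynomial $W^{(r)}(Z)$ is called the $r$-th generalized weight enumerator of $C_3$. Equivalently, $r$-dimensional subcodes of $C_3$ correspond to codimension-$r$ projective subspaces $\mathcal{L}$ of $PG(9,3)$, and the support size equals the number of points of $\iota(PG(3,3))$ not lying on $\mathcal{L}$. *)

theory Defs
  imports "HOL-Analysis.Analysis" "HOL-Computational_Algebra.Polynomial"
begin

text \<open>The points of the projective space on \<open>'k ^ 'n\<close> are its one-dimensional linear subspaces.\<close>

definition proj_points :: "('k::field ^ 'n) set set" where
  "proj_points = {Q. vec.subspace Q \<and> vec.dim Q = 1}"

definition represents :: "'k::field ^ 'n \<Rightarrow> ('k ^ 'n) set \<Rightarrow> bool" where
  "represents v Q \<longleftrightarrow> v \<noteq> 0 \<and> Q = vec.span {v}"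

text \<open>
  In \<open>'k ^ 4\<close> the coordinates \<open>x\<^sub>0, \<dots>, x\<^sub>3\<close> are indexed by \<open>0, 1, 2, 3\<close> of the numeral type
  \<open>4\<close>.  The function \<open>vector\<close> fills the positions \<open>1, \<dots>, 10\<close> of the numeral type \<open>10\<close>
  (where \<open>10 = 0\<close>).
\<close>

definition veronese :: "'k::field ^ 4 \<Rightarrow> 'k ^ 10" where
  "veronese x = vector
     [x$0 * x$0, x$0 * x$1, x$1 * x$1, x$0 * x$2, x$1 * x$2, x$2 * x$2,
      x$0 * x$3, x$1 * x$3, x$2 * x$3, x$3 * x$3]"

text \<open>
  Since \<open>veronese (c *s x) = c\<^sup>2 *s veronese x\<close>, the span of the image of a point is again a
  point; see \<open>represents_veronese_point\<close> below.
\<close>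

definition veronese_point :: "('k::field ^ 4) set \<Rightarrow> ('k ^ 10) set" where
  "veronese_point Q = vec.span (veronese ` Q)"

definition is_veronese_matrix :: "(40 \<Rightarrow> ('k::field ^ 4) set) \<Rightarrow> 'k ^ 40 ^ 10 \<Rightarrow> bool" where
  "is_veronese_matrix P G \<longleftrightarrow> (\<forall>j. represents (column j G) (veronese_point (P j)))"

definition generated_code :: "'k::field ^ 'n ^ 'm \<Rightarrow> ('k ^ 'n) set" where
  "generated_code G = vec.span (rows G)"

definition code_supp :: "('k::field ^ 'n) set \<Rightarrow> 'n set" where
  "code_supp D = {i. \<exists>c\<in>D. c $ i \<noteq> 0}"

definition subcodes :: "nat \<Rightarrow> ('k::field ^ 'n) set \<Rightarrow> ('k ^ 'n) set set" where
  "subcodes r C = {D. vec.subspace D \<and> D \<subseteq> C \<and> vec.dim D = r}"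

definition gen_weight_enum :: "nat \<Rightarrow> ('k::field ^ 'n) set \<Rightarrow> int poly" where
  "gen_weight_enum r C = (\<Sum>D\<in>subcodes r C. monom 1 (card (code_supp D)))"

definition gen_hamming_weight :: "nat \<Rightarrow> ('k::field ^ 'n) set \<Rightarrow> nat" where
  "gen_hamming_weight r C = Min ((\<lambda>D. card (code_supp D)) ` subcodes r C)"

lemma UNIV_10: "(UNIV :: 10 set) = {1, 2, 3, 4, 5, 6, 7, 8, 9, 10}"
proof -
  have "card {1, 2, 3, 4, 5, 6, 7, 8, 9, 10 :: 10} = CARD(10)"
    by simp
  then show ?thesis
    by (metis card_subset_eq finite subset_UNIV)
qed

lemma forall_10:
  "(\<forall>i::10. R i) \<longleftrightarrow>
     R 1 \<and> R 2 \<and> R 3 \<and> R 4 \<and> R 5 \<and> R 6 \<and> R 7 \<and> R 8 \<and> R 9 \<and> R 10"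
proof -
  have "(\<forall>i::10. R i) \<longleftrightarrow> (\<forall>i\<in>UNIV. R i)"
    by simp
  then show ?thesis
    by (simp only: UNIV_10) simp
qed

lemma veronese_nth:
  fixes x :: "'k::field ^ 4"
  shows "veronese x $ 1 = x$0 * x$0" "veronese x $ 2 = x$0 * x$1"
    "veronese x $ 3 = x$1 * x$1" "veronese x $ 4 = x$0 * x$2"
    "veronese x $ 5 = x$1 * x$2" "veronese x $ 6 = x$2 * x$2"
    "veronese x $ 7 = x$0 * x$3" "veronese x $ 8 = x$1 * x$3"
    "veronese x $ 9 = x$2 * x$3" "veronese x $ 10 = x$3 * x$3"
  by (simp_all add: veronese_def vector_def)

lemma veronese_scale:
  fixes x :: "'k::field ^ 4"
  shows "veronese (c *s x) = c\<^sup>2 *s veronese x"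
  by (simp add: vec_eq_iff forall_10 veronese_nth power2_eq_square del: mult_eq_0_iff)

lemma veronese_eq_0_iff:
  fixes x :: "'k::field ^ 4"
  shows "veronese x = 0 \<longleftrightarrow> x = 0"
proof
  assume "veronese x = 0"
  then have "x$0 = 0" "x$1 = 0" "x$2 = 0" "x$3 = 0"
    by (auto simp: vec_eq_iff forall_10 veronese_nth)
  moreover from this(1) have "x$4 = 0"
    using arg_cong[of "4::4" 0 "($) x"] by simp
  ultimately show "x = 0"
    using forall_4[of "\<lambda>i. x $ i = 0"] by (simp add: vec_eq_iff)
qed (simp add: vec_eq_iff forall_10 veronese_nth)

lemma represents_veronese_point:
  fixes x :: "'k::field ^ 4"
  assumes "represents x Q"
  shows "represents (veronese x) (veronese_point Q)"
proof -
  have Q: "Q = range (\<lambda>c. c *s x)" and "x \<noteq> 0"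
    using assms by (auto simp: represents_def vec.span_singleton)
  have "veronese ` Q \<subseteq> vec.span {veronese x}"
    by (auto simp: Q veronese_scale vec.span_singleton)
  moreover have "veronese x \<in> veronese ` Q"
    using assms by (auto simp: represents_def intro: vec.span_base)
  ultimately have "vec.span (veronese ` Q) = vec.span {veronese x}"
    by (meson bot.extremum insert_subset subset_antisym vec.span_minimal vec.span_mono
        vec.subspace_span)
  with \<open>x \<noteq> 0\<close> show ?thesis
    by (simp add: represents_def veronese_point_def veronese_eq_0_iff)
qed

end

theory Submission
  imports Defs
begin

text \<open>
  An \<open>r\<close>-dimensional subcode corresponds to an \<open>r\<close>-dimensional linear system \<open>D\<close> of quadrics of
  \<open>PG(3,3)\<close>, and its weight is \<open>40\<close> minus the number of base points of \<open>D\<close>.  For a set \<open>J\<close> of points let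
  \<open>W(J)\<close> be the number of quadratic forms that vanish on \<open>J\<close>.  Expanding \<open>z\<^sup>n = \<Sum>\<^sub>J (z - 1)\<^bsup>|J|\<^esup>\<close> over the
  sets \<open>J\<close> of base points, and counting the \<open>r\<close>-dimensional subspaces of a space with \<open>W\<close> elements by their
  ordered bases, gives
  \<open>\<Prod>\<^sub>i\<^sub><\<^sub>r (3\<^sup>r - 3\<^sup>i) \<cdot> \<Sum>\<^sub>D z\<^bsup>n(D)\<^esup> = \<Sum>\<^sub>J (z - 1)\<^bsup>|J|\<^esup> \<Prod>\<^sub>i\<^sub><\<^sub>r (W(J) - 3\<^sup>i)\<close>.
  The factor \<open>W(J) - 1\<close> counts the nonzero forms \<open>f\<close> that vanish on \<open>J\<close>, so the right-hand side is a sum over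
  \<open>f\<close> of sums over subsets of the zero set of \<open>f\<close>.  The summand only depends on the projective class of \<open>f\<close>:
  a double plane (80 forms), a pair of planes (1560), a pair of conjugate planes meeting in a line (780), a cone
  (18720), a hyperbolic quadric (21060) or an elliptic quadric (16848).  For a representative of each class
  the sum over subsets is evaluated by deletion and contraction, eliminating one coefficient of the form at
  a time and merging equal intermediate arrangements.
\<close>

section \<open>Deletion and contraction for ternary linear forms\<close>

text \<open>
  Neither \<open>if\<close> nor \<open>case\<close> occurs in the functions below: their weak congruence rules would make
  \<open>code_simp\<close> traverse whole search trees again after each rewrite step.
\<close>

datatype tri = Tz | Tp | Tn
datatype comparison = Lt | Eq | Gt

fun tneg :: "tri \<Rightarrow> tri" where
  "tneg Tz = Tz" | "tneg Tp = Tn" | "tneg Tn = Tp"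

fun tsub :: "tri \<Rightarrow> tri \<Rightarrow> tri" where
  "tsub Tz Tz = Tz" | "tsub Tz Tp = Tn" | "tsub Tz Tn = Tp"
| "tsub Tp Tz = Tp" | "tsub Tp Tp = Tz" | "tsub Tp Tn = Tn"
| "tsub Tn Tz = Tn" | "tsub Tn Tp = Tp" | "tsub Tn Tn = Tz"

fun tnegs :: "tri list \<Rightarrow> tri list" where
  "tnegs [] = []" | "tnegs (a # x) = tneg a # tnegs x"

fun tsubs :: "tri list \<Rightarrow> tri list \<Rightarrow> tri list" where
  "tsubs (a # x) (b # y) = tsub a b # tsubs x y" | "tsubs _ _ = []"

text \<open>Proportional forms have the same kernel; scaling the first nonzero coefficient to 1
  makes them syntactically equal, so that they can be merged.\<close>

fun tnorm :: "tri list \<Rightarrow> tri list" where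
  "tnorm [] = []" | "tnorm (Tz # x) = Tz # tnorm x" | "tnorm (Tp # x) = Tp # x"
| "tnorm (Tn # x) = Tp # tnegs x"

fun tzero :: "tri list \<Rightarrow> bool" where
  "tzero [] = True" | "tzero (Tz # x) = tzero x" | "tzero (Tp # x) = False" | "tzero (Tn # x) = False"

fun tcmp :: "tri list \<Rightarrow> tri list \<Rightarrow> comparison" where
  "tcmp [] [] = Eq" | "tcmp [] (_ # _) = Lt" | "tcmp (_ # _) [] = Gt"
| "tcmp (Tz # x) (Tz # y) = tcmp x y" | "tcmp (Tz # x) (Tp # y) = Lt" | "tcmp (Tz # x) (Tn # y) = Lt"
| "tcmp (Tp # x) (Tz # y) = Gt" | "tcmp (Tp # x) (Tp # y) = tcmp x y" | "tcmp (Tp # x) (Tn # y) = Lt"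
| "tcmp (Tn # x) (Tz # y) = Gt" | "tcmp (Tn # x) (Tp # y) = Gt" | "tcmp (Tn # x) (Tn # y) = tcmp x y"

fun ncmp :: "nat \<Rightarrow> nat \<Rightarrow> comparison" where
  "ncmp 0 0 = Eq" | "ncmp 0 (Suc n) = Lt" | "ncmp (Suc n) 0 = Gt" | "ncmp (Suc m) (Suc n) = ncmp m n"

text \<open>An entry \<open>(c, m)\<close> stands for \<open>m\<close> copies of the kernel of the
  form \<open>c\<close>.\<close>

type_synonym arrangement = "(tri list \<times> nat) list"

function (sequential) scmp :: "arrangement \<Rightarrow> arrangement \<Rightarrow> comparison"
  and scmp_tail :: "comparison \<Rightarrow> arrangement \<Rightarrow> arrangement \<Rightarrow> comparison"
  and scmp_nat :: "comparison \<Rightarrow> nat \<Rightarrow> nat \<Rightarrow> arrangement \<Rightarrow> arrangement \<Rightarrow> comparison" where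
  "scmp [] [] = Eq" | "scmp [] (_ # _) = Lt" | "scmp (_ # _) [] = Gt"
| "scmp ((c, m) # L) ((d, n) # M) = scmp_nat (tcmp c d) m n L M"
| "scmp_nat Lt m n L M = Lt" | "scmp_nat Gt m n L M = Gt"
| "scmp_nat Eq m n L M = scmp_tail (ncmp m n) L M"
| "scmp_tail Lt L M = Lt" | "scmp_tail Gt L M = Gt"
| "scmp_tail Eq L M = scmp L M"
  by pat_completeness auto
termination
  by (relation "Wellfounded.measure (case_sum (\<lambda>(L, M). 3 * length L) (case_sum (\<lambda>(_, L, M). 3 * length L + 1) (\<lambda>(_, _, _, L, M). 3 * length L + 2)))") auto

function (sequential) ins :: "tri list \<Rightarrow> nat \<Rightarrow> arrangement \<Rightarrow> arrangement"
  and ins_cmp :: "comparison \<Rightarrow> tri list \<Rightarrow> nat \<Rightarrow> tri list \<Rightarrow> nat \<Rightarrow> arrangement \<Rightarrow> arrangement" where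
  "ins c m [] = [(c, m)]"
| "ins c m ((d, n) # L) = ins_cmp (tcmp c d) c m d n L"
| "ins_cmp Lt c m d n L = (c, m) # (d, n) # L"
| "ins_cmp Eq c m d n L = (d, m + n) # L"
| "ins_cmp Gt c m d n L = (d, n) # ins c m L"
  by pat_completeness auto
termination
  by (relation "Wellfounded.measure (case_sum (\<lambda>(c, m, L). 2 * length L) (\<lambda>(_, c, m, d, n, L). 2 * length L + 1))") auto

text \<open>The first component collects the forms without the leading variable, the second those
  with it, rescaled to leading coefficient 1. In both the leading coefficient is dropped.\<close>

fun split_cons :: "tri list \<Rightarrow> nat \<Rightarrow> arrangement \<times> arrangement \<Rightarrow> arrangement \<times> arrangement" where
  "split_cons (Tz # c) m (A, B) = ((c, m) # A, B)"
| "split_cons (Tp # c) m (A, B) = (A, (c, m) # B)"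
| "split_cons (Tn # c) m (A, B) = (A, (tnegs c, m) # B)"
| "split_cons [] m AB = AB"

fun split_head :: "arrangement \<Rightarrow> arrangement \<times> arrangement" where
  "split_head [] = ([], [])"
| "split_head ((c, m) # L) = split_cons c m (split_head L)"

text \<open>The row at index \<open>k\<close> is a polynomial in \<open>z\<close>, namely the
  coefficient with which \<open>w (3 ^ k)\<close> enters the result.\<close>

type_synonym bipoly = "int list list"

fun radd :: "int list \<Rightarrow> int list \<Rightarrow> int list" where
  "radd [] q = q" | "radd (a # p) [] = a # p" | "radd (a # p) (b # q) = (a + b) # radd p q"

fun rsub :: "int list \<Rightarrow> int list \<Rightarrow> int list" where
  "rsub p [] = p" | "rsub [] (b # q) = (- b) # rsub [] q" | "rsub (a # p) (b # q) = (a - b) # rsub p q"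

fun rshift :: "nat \<Rightarrow> int list \<Rightarrow> int list" where
  "rshift 0 p = p" | "rshift (Suc n) p = 0 # rshift n p"

fun badd :: "bipoly \<Rightarrow> bipoly \<Rightarrow> bipoly" where
  "badd [] q = q" | "badd (a # p) [] = a # p" | "badd (a # p) (b # q) = radd a b # badd p q"

fun bshift :: "nat \<Rightarrow> bipoly \<Rightarrow> bipoly" where
  "bshift n [] = []" | "bshift n ([] # p) = [] # bshift n p"
| "bshift n ((a # r) # p) = rshift n (a # r) # bshift n p"

fun bmul :: "nat \<Rightarrow> bipoly \<Rightarrow> bipoly" where
  "bmul n [] = []" | "bmul n ([] # p) = [] # bmul n p"
| "bmul n ((a # r) # p) = rsub (rshift n (a # r)) (a # r) # bmul n p"

section \<open>Elimination over a search tree of arrangements\<close>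

datatype state_tree = Lf | Nd state_tree arrangement bipoly state_tree

function (sequential) tins :: "arrangement \<Rightarrow> bipoly \<Rightarrow> state_tree \<Rightarrow> state_tree"
  and tins_cmp :: "comparison \<Rightarrow> arrangement \<Rightarrow> bipoly \<Rightarrow> state_tree \<Rightarrow> state_tree" where
  "tins s p Lf = Nd Lf s p Lf"
| "tins s p (Nd l t q r) = tins_cmp (scmp s t) s p (Nd l t q r)"
| "tins_cmp Lt s p (Nd l t q r) = Nd (tins s p l) t q r"
| "tins_cmp Eq s p (Nd l t q r) = Nd l t (badd p q) r"
| "tins_cmp Gt s p (Nd l t q r) = Nd l t q (tins s p r)"
| "tins_cmp _ s p Lf = Nd Lf s p Lf"
  by pat_completeness auto
termination
  by (relation "Wellfounded.measure (case_sum (\<lambda>(s, p, t). 2 * size t + 1) (\<lambda>(_, s, p, t). 2 * size t))") auto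

fun put_zero :: "bool \<Rightarrow> tri list \<Rightarrow> nat \<Rightarrow> arrangement \<Rightarrow> bipoly \<Rightarrow> state_tree \<Rightarrow> state_tree" where
  "put_zero True c m L p t = tins L (bshift m p) t"
| "put_zero False c m L p t = tins ((c, m) # L) p t"

text \<open>The zero form is the least one for \<open>tcmp\<close>, so in a sorted arrangement it
  can only stand at the head. Its \<open>m\<close> copies contribute
  \<open>1 + (z ^ m - 1) = z ^ m\<close>.\<close>

fun put :: "arrangement \<Rightarrow> bipoly \<Rightarrow> state_tree \<Rightarrow> state_tree" where
  "put [] p t = tins [] p t"
| "put ((c, m) # L) p t = put_zero (tzero c) c m L p t"

text \<open>On the hyperplane \<open>x + c = 0\<close> the form \<open>x + d\<close> restricts to
  \<open>d - c\<close>.\<close>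

fun subst_tail :: "tri list \<Rightarrow> arrangement \<Rightarrow> arrangement" where
  "subst_tail c [] = []" | "subst_tail c ((d, n) # B) = (tsubs d c, n) # subst_tail c B"

fun ins_all :: "arrangement \<Rightarrow> arrangement \<Rightarrow> arrangement" where
  "ins_all [] A = A" | "ins_all ((c, m) # L) A = ins (tnorm c) m (ins_all L A)"

text \<open>The forms in \<open>B\<close> have an implicit leading coefficient 1. Deleting the first
  of them continues with the rest of \<open>B\<close>; contracting to it gains the factor
  \<open>z ^ m - 1\<close> and solves for the leading variable. If \<open>B\<close> is empty this
  variable is free, which is the shift \<open>[] # p\<close>. For a single form both branches leave
  \<open>A\<close> and are combined into one state.\<close>

fun contract :: "arrangement \<Rightarrow> bipoly \<Rightarrow> arrangement \<Rightarrow> state_tree \<Rightarrow> state_tree" where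
  "contract A p [] t = put A ([] # p) t"
| "contract A p [(c, m)] t = put A (badd ([] # p) (bmul m p)) t"
| "contract A p ((c, m) # b # B) t =
    put (ins_all (subst_tail c (b # B)) A) (bmul m p) (contract A p (b # B) t)"

fun contract_pair :: "bipoly \<Rightarrow> arrangement \<times> arrangement \<Rightarrow> state_tree \<Rightarrow> state_tree" where
  "contract_pair p (A, B) t = contract A p B t"

text \<open>The argument \<open>t\<close> accumulates the new states, so equal arrangements that
  arise from different states are merged.\<close>

fun step :: "state_tree \<Rightarrow> state_tree \<Rightarrow> state_tree" where
  "step Lf t = t"
| "step (Nd l s p r) t = step l (contract_pair p (split_head s) (step r t))"

fun steps :: "nat \<Rightarrow> state_tree \<Rightarrow> state_tree" where
  "steps 0 t = t" | "steps (Suc n) t = steps n (step t Lf)"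

section \<open>Meaning of the symbolic objects\<close>

fun tk :: "tri \<Rightarrow> 'k::field" where "tk Tz = 0" | "tk Tp = 1" | "tk Tn = - 1"

fun dot :: "'k::field list \<Rightarrow> 'k list \<Rightarrow> 'k" where
  "dot (a # x) (b # y) = a * b + dot x y" | "dot _ _ = 0"

definition ker_form :: "tri list \<Rightarrow> 'k::field list set" where
  "ker_form c = {a. dot (map tk c) a = 0}"

definition kspace :: "nat \<Rightarrow> 'k::field list set" where
  "kspace n = {a. length a = n}"

text \<open>
  \<open>w\<close> is applied to a number of solutions.  A variable that no form involves multiplies this number
  by \<open>3\<close>, so in \<open>eval_bipoly\<close> the outer indeterminate acts as \<open>w \<mapsto> (\<lambda>c. w (3 * c))\<close>.
\<close>

fun subset_sum :: "(nat \<Rightarrow> 'r::comm_ring_1) \<Rightarrow> 'r \<Rightarrow> 'k::field list set \<Rightarrow> arrangement \<Rightarrow> 'r" where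
  "subset_sum w z K [] = w (card K)"
| "subset_sum w z K ((c,m) # L) = subset_sum w z K L + (z ^ m - 1) * subset_sum w z (K \<inter> ker_form c) L"

fun eval_row :: "'r::comm_ring_1 \<Rightarrow> int list \<Rightarrow> 'r" where
  "eval_row z [] = 0" | "eval_row z (a # r) = of_int a + z * eval_row z r"

fun eval_bipoly :: "'r::comm_ring_1 \<Rightarrow> bipoly \<Rightarrow> ((nat \<Rightarrow> 'r) \<Rightarrow> 'r) \<Rightarrow> (nat \<Rightarrow> 'r) \<Rightarrow> 'r" where
  "eval_bipoly z [] F w = 0"
| "eval_bipoly z (r # p) F w = eval_row z r * F w + eval_bipoly z p F (\<lambda>c. w (3 * c))"

section \<open>Soundness of the operations on lists\<close>

lemma tnegs_map: "tnegs c = map tneg c"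
  by (induction c) auto

lemma tcmp_Eq: "tcmp c d = Eq \<Longrightarrow> c = d"
  by (induction c d rule: tcmp.induct) auto

lemma ncmp_Eq: "ncmp m n = Eq \<Longrightarrow> m = n"
  by (induction m n rule: ncmp.induct) auto

text \<open>Coefficients of two states are added on the outcome \<open>Eq\<close>; this lemma makes
  the merging in \<open>tins\<close> sound.\<close>

lemma scmp_Eq:
  "scmp s t = Eq \<Longrightarrow> s = t"
  "scmp_tail r s t = Eq \<Longrightarrow> r = Eq \<and> s = t"
  "scmp_nat r m n s t = Eq \<Longrightarrow> r = Eq \<and> m = n \<and> s = t"
  by (induction s t and r s t and r m n s t rule: scmp_scmp_tail_scmp_nat.induct)
    (auto dest: tcmp_Eq ncmp_Eq)

lemma eval_row_radd: "eval_row z (radd p q) = eval_row z p + eval_row z q"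
  by (induction p q rule: radd.induct) (auto simp: algebra_simps)

lemma eval_row_rsub: "eval_row z (rsub p q) = eval_row z p - eval_row z q"
  by (induction p q rule: rsub.induct) (auto simp: right_diff_distrib)

lemma eval_row_rshift: "eval_row z (rshift n p) = z ^ n * eval_row z p"
  by (induction n) (auto simp: algebra_simps)

lemma eval_bipoly_badd: "eval_bipoly z (badd p q) F w = eval_bipoly z p F w + eval_bipoly z q F w"
  by (induction p q arbitrary: w rule: badd.induct) (auto simp: algebra_simps eval_row_radd)

lemma eval_bipoly_bshift: "eval_bipoly z (bshift n p) F w = z ^ n * eval_bipoly z p F w"
  by (induction n p arbitrary: w rule: bshift.induct)
    (simp_all add: algebra_simps eval_row_rshift del: eval_row.simps(2))

lemma eval_bipoly_bmul: "eval_bipoly z (bmul n p) F w = (z ^ n - 1) * eval_bipoly z p F w"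
  by (induction n p arbitrary: w rule: bmul.induct)
    (simp_all add: algebra_simps eval_row_rshift eval_row_rsub del: eval_row.simps(2))

lemma eval_bipoly_add_mult: "eval_bipoly z p (\<lambda>w. F w + x * G w) w = eval_bipoly z p F w + x * eval_bipoly z p G w"
  by (induction p arbitrary: w) (auto simp: algebra_simps)

lemma eval_bipoly_mult: "eval_bipoly z p (\<lambda>w. x * G w) w = x * eval_bipoly z p G w"
  by (induction p arbitrary: w) (auto simp: algebra_simps)

text \<open>A factor of the outer indeterminate can be moved into the functional \<open>F\<close>,
  which then sees the weight with its argument tripled. A free variable appears in this
  form.\<close>

lemma eval_bipoly_Nil_Cons: "eval_bipoly z ([] # p) F w = eval_bipoly z p (\<lambda>w. F (\<lambda>c. w (3 * c))) w"
proof -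
  have "eval_bipoly z p F (\<lambda>c. w (3 * c)) = eval_bipoly z p (\<lambda>w. F (\<lambda>c. w (3 * c))) w"
  proof (induction p arbitrary: w)
    case (Cons r p)
    show ?case
      using Cons[of "\<lambda>c. w (3 * c)"] by simp
  qed simp
  then show ?thesis
    by simp
qed

text \<open>Intersections of kernels commute.\<close>

lemma subset_sum_swap:
  fixes K :: "'k::field list set"
  shows "subset_sum w z K (xs @ a # ys) = subset_sum w z K (a # xs @ ys)"
proof (induction xs arbitrary: K)
  case Nil
  then show ?case by simp
next
  case (Cons b xs)
  obtain c m d n where ab: "a = (c, m)" "b = (d, n)"
    by fastforce
  have IH: "subset_sum w z K (xs @ (c, m) # ys) = subset_sum w z K ((c, m) # xs @ ys)" for K :: "'k list set"
    using Cons by (simp add: ab)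
  show ?case
    by (simp add: ab IH algebra_simps Int_ac)
qed

text \<open>Adding multiplicities on a common kernel rests on \<open>(z ^ m - 1) + (z ^ n - 1) + (z
  ^ m - 1) * (z ^ n - 1) = z ^ (m + n) - 1\<close>. The helper receives the result of the comparison
  as an argument, hence the premise on \<open>Eq\<close>.\<close>

lemma subset_sum_ins:
  "subset_sum w z K (ins c m L) = subset_sum w z K ((c, m) # L)"
  "(r = Eq \<Longrightarrow> c = d) \<Longrightarrow> subset_sum w z K (ins_cmp r c m d n L) = subset_sum w z K ((c, m) # (d, n) # L)"
proof (induction c m L and r c m d n L arbitrary: K and K rule: ins_ins_cmp.induct)
  case (2 c m d n L)
  then show ?case
    by (simp add: tcmp_Eq del: subset_sum.simps)
next
  case (4 c m d n L)
  then show ?case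
    by (simp add: algebra_simps power_add Int_assoc)
next
  case (5 c m d n L)
  show ?case
    by (simp add: 5 algebra_simps Int_ac)
qed simp_all

text \<open>\<open>dot\<close> and \<open>tsubs\<close> truncate to the shorter list; this invariant
  says that every form has one coefficient per variable.\<close>

definition lengths :: "nat \<Rightarrow> arrangement \<Rightarrow> bool" where
  "lengths n s \<longleftrightarrow> (\<forall>(c, m) \<in> set s. length c = n)"

lemma lengths_simps [simp]:
  "lengths n []" "lengths n ((c, m) # s) \<longleftrightarrow> length c = n \<and> lengths n s"
  "lengths n (s @ t) \<longleftrightarrow> lengths n s \<and> lengths n t"
  by (auto simp: lengths_def)

lemma length_tnorm [simp]: "length (tnorm c) = length c"
  by (induction c rule: tnorm.induct) (auto simp: tnegs_map)

lemma length_tsubs [simp]: "length (tsubs c d) = min (length c) (length d)"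
  by (induction c d rule: tsubs.induct) auto

lemma lengths_ins [simp]:
  "lengths k (ins c m s) \<longleftrightarrow> length c = k \<and> lengths k s"
  "(r = Eq \<Longrightarrow> c = d) \<Longrightarrow>
    lengths k (ins_cmp r c m d n s) \<longleftrightarrow> length c = k \<and> length d = k \<and> lengths k s"
  by (induction c m s and r c m d n s rule: ins_ins_cmp.induct) (auto dest: tcmp_Eq)

lemma lengths_subst_tail [simp]:
  "length c = n \<Longrightarrow> lengths n s \<Longrightarrow> lengths n (subst_tail c s)"
  by (induction c s rule: subst_tail.induct) auto

lemma lengths_ins_all [simp]: "lengths n (ins_all s t) \<longleftrightarrow> lengths n s \<and> lengths n t"
  by (induction s t rule: ins_all.induct) auto

lemma lengths_split_head:
  "lengths (Suc n) s \<Longrightarrow> split_head s = (A, B) \<Longrightarrow> lengths n A \<and> lengths n B"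
proof (induction s arbitrary: A B rule: split_head.induct)
  case (2 c m L)
  obtain A' B' where "split_head L = (A', B')"
    by fastforce
  moreover obtain t c' where "c = t # c'"
    using 2 by (cases c) auto
  ultimately show ?case
    using 2 by (cases t) (auto simp: tnegs_map)
qed auto

fun tree_all :: "(arrangement \<Rightarrow> bool) \<Rightarrow> state_tree \<Rightarrow> bool" where
  "tree_all P Lf \<longleftrightarrow> True"
| "tree_all P (Nd l s p r) \<longleftrightarrow> tree_all P l \<and> P s \<and> tree_all P r"

lemma tree_all_tins:
  "P s \<Longrightarrow> tree_all P t \<Longrightarrow> tree_all P (tins s p t)"
  "P s \<Longrightarrow> tree_all P t \<Longrightarrow> tree_all P (tins_cmp r s p t)"
  by (induction s p t and r s p t rule: tins_tins_cmp.induct) auto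

lemma tree_all_put: "lengths n s \<Longrightarrow> tree_all (lengths n) t \<Longrightarrow> tree_all (lengths n) (put s p t)"
proof (induction s p t rule: put.induct)
  case (2 c m L p t)
  then show ?case
    by (cases "tzero c") (auto intro!: tree_all_tins(1))
qed (auto intro!: tree_all_tins(1))

lemma tree_all_contract:
  "lengths n A \<Longrightarrow> lengths n B \<Longrightarrow> tree_all (lengths n) t \<Longrightarrow> tree_all (lengths n) (contract A p B t)"
  by (induction A p B t rule: contract.induct) (auto intro!: tree_all_put)

lemma tree_all_step:
  "tree_all (lengths (Suc n)) s \<Longrightarrow> tree_all (lengths n) t \<Longrightarrow> tree_all (lengths n) (step s t)"
proof (induction s t rule: step.induct)
  case (2 l s p r t)
  obtain A B where "split_head s = (A, B)"
    by fastforce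
  with 2 lengths_split_head[of n s A B] show ?case
    by (auto intro!: 2 tree_all_contract)
qed auto

lemma kspace_0: "kspace 0 = {[]}"
  by (auto simp: kspace_def)

text \<open>The quantity that elimination preserves: the weighted total of all states over the space
  \<open>K\<close> of the remaining variables.\<close>

fun tree_val :: "'k::field list set \<Rightarrow> (nat \<Rightarrow> 'r::comm_ring_1) \<Rightarrow> 'r \<Rightarrow> state_tree \<Rightarrow> 'r" where
  "tree_val K w z Lf = 0"
| "tree_val K w z (Nd l s p r) = tree_val K w z l + eval_bipoly z p (\<lambda>w. subset_sum w z K s) w + tree_val K w z r"

lemma tree_val_tins:
  "tree_val K w z (tins s p t) = eval_bipoly z p (\<lambda>w. subset_sum w z K s) w + tree_val K w z t"
  "(\<And>l u q v. t = Nd l u q v \<Longrightarrow> r = Eq \<Longrightarrow> s = u) \<Longrightarrow>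
    tree_val K w z (tins_cmp r s p t) = eval_bipoly z p (\<lambda>w. subset_sum w z K s) w + tree_val K w z t"
  by (induction s p t and r s p t rule: tins_tins_cmp.induct)
    (auto dest: scmp_Eq(1) simp: eval_bipoly_badd algebra_simps)

section \<open>The field with three elements\<close>

locale ternary =
  fixes ty :: "'k::field itself"
  assumes card3: "CARD('k) = 3"
begin

lemma finite_UNIV_k [simp]: "finite (UNIV :: 'k set)"
  using card3 by (metis card.infinite zero_neq_numeral)

lemma not_distinct4: "\<not> distinct [a, b, c, d :: 'k]"
proof
  assume "distinct [a, b, c, d]"
  then have "card (set [a, b, c, d]) = 4"
    by (simp only: distinct_card) simp
  moreover have "card (set [a, b, c, d]) \<le> CARD('k)"
    by (intro card_mono) auto
  ultimately show False
    using card3 by simp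
qed

text \<open>Only the cardinality is given. If \<open>1 + 1 = 0\<close>, a third element
  \<open>x\<close> would give four elements \<open>0\<close>, \<open>1\<close>, \<open>x\<close>,
  \<open>x + 1\<close>. Otherwise \<open>0\<close>, \<open>1\<close>, \<open>1 + 1\<close>,
  \<open>- 1\<close> cannot all be distinct, and the only possible coincidence is the claim.\<close>

lemma one_plus_one: "(1::'k) + 1 = - 1"
proof (cases "(1::'k) + 1 = 0")
  case True
  have "\<not> (UNIV :: 'k set) \<subseteq> {0, 1}"
    using card_mono[of "{0, 1 :: 'k}" UNIV] card3 by fastforce
  then obtain x :: 'k where x: "x \<noteq> 0" "x \<noteq> 1"
    by auto
  have "x + 1 \<noteq> 0"
    using x True by (metis add_right_cancel)
  with x not_distinct4[of 0 1 x "x + 1"] show ?thesis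
    by simp
next
  case False
  then have "(- 1 :: 'k) \<noteq> 1"
    by (metis add.left_inverse)
  moreover have "(1::'k) + 1 \<noteq> 1"
    by (metis add_cancel_right_left zero_neq_one)
  ultimately show ?thesis
    using not_distinct4[of 0 1 "1 + 1" "- 1"] False
    by (simp only: distinct.simps list.set insert_iff empty_iff) (metis neg_equal_0_iff_equal zero_neq_one)
qed

lemma neg_one_neq_one: "(- 1 :: 'k) \<noteq> 1"
  using one_plus_one by (metis add_cancel_right_left zero_neq_one)

lemma UNIV_k: "(UNIV :: 'k set) = {0, 1, - 1}"
proof -
  have "card {0, 1, - 1 :: 'k} = CARD('k)"
    using card3 neg_one_neq_one by simp
  then show ?thesis
    by (metis card_subset_eq finite_UNIV_k subset_UNIV)
qed

lemma k_cases: "(x::'k) = 0 \<or> x = 1 \<or> x = - 1"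
  using UNIV_k by auto

lemma add_self: "(x::'k) + x = - x"
proof -
  have "x + x = (1 + 1) * x"
    by (simp only: distrib_right mult_1_left)
  then show ?thesis
    by (simp only: one_plus_one mult_minus1)
qed

lemma tk_tneg: "tk (tneg t) = - (tk t :: 'k)"
  by (cases t) auto

lemma tk_tsub: "tk (tsub s t) = (tk s - tk t :: 'k)"
proof -
  have "(- 1 :: 'k) - 1 = 1"
    using add_self[of 1] by (metis add_diff_cancel_left' add_uminus_conv_diff minus_add_distrib one_plus_one)
  moreover have "(1 :: 'k) - (- 1) = - 1"
    by (simp only: diff_minus_eq_add one_plus_one)
  ultimately show ?thesis
    by (cases s; cases t) (simp_all only: tsub.simps tk.simps diff_self diff_0 diff_0_right minus_minus)
qed

lemma dot_tnegs: "dot (map tk (tnegs c)) a = - (dot (map tk c) a :: 'k)"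
proof (induction c arbitrary: a)
  case (Cons t c)
  then show ?case
    by (cases a) (auto simp: tk_tneg)
qed auto

lemma dot_tsubs:
  "length c = length d \<Longrightarrow> dot (map tk (tsubs c d)) a = (dot (map tk c) a - dot (map tk d) a :: 'k)"
proof (induction c d arbitrary: a rule: tsubs.induct)
  case (1 s c t d)
  then show ?case
    by (cases a) (auto simp: tk_tsub algebra_simps)
qed auto

text \<open>Normalization changes the values of a form at most by a common sign.\<close>

lemma ker_form_tnorm: "ker_form (tnorm c) = (ker_form c :: 'k list set)"
proof -
  have "dot (map tk (tnorm c)) a = (dot (map tk c) a :: 'k) \<or>
        dot (map tk (tnorm c)) a = - (dot (map tk c) a :: 'k)" for a
  proof (induction c arbitrary: a rule: tnorm.induct)
    case (2 x)
    then show ?case by (cases a) auto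
  next
    case (4 x)
    then show ?case by (cases a) (auto simp: dot_tnegs)
  qed auto
  then have "dot (map tk (tnorm c)) a = (0 :: 'k) \<longleftrightarrow> dot (map tk c) a = (0 :: 'k)" for a
    by (metis neg_equal_0_iff_equal)
  then show ?thesis
    by (simp add: ker_form_def)
qed

lemma ker_form_tzero:
  assumes "tzero c"
  shows "ker_form c = (UNIV :: 'k list set)"
proof -
  have "tzero c \<Longrightarrow> dot (map tk c) a = (0 :: 'k)" for a
  proof (induction c arbitrary: a rule: tzero.induct)
    case (2 x)
    then show ?case by (cases a) auto
  qed auto
  with assms show ?thesis
    by (auto simp: ker_form_def)
qed

lemma subset_sum_ins_all:
  fixes K :: "'k list set"
  shows "subset_sum w z K (ins_all L A) = subset_sum w z K (L @ A)"
  by (induction L A arbitrary: K rule: ins_all.induct) (auto simp: subset_sum_ins ker_form_tnorm)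

section \<open>Elimination of the leading variable\<close>

abbreviation lift0 :: "arrangement \<Rightarrow> arrangement" where "lift0 \<equiv> map (\<lambda>(c, m). (Tz # c, m))"
abbreviation lift1 :: "arrangement \<Rightarrow> arrangement" where "lift1 \<equiv> map (\<lambda>(c, m). (Tp # c, m))"

lemma subset_sum_split_head:
  fixes K :: "'k list set"
  assumes "lengths (Suc n) s" "split_head s = (A, B)"
  shows "subset_sum w z K s = subset_sum w z K (lift1 B @ lift0 A)"
  using assms
proof (induction s arbitrary: A B K rule: split_head.induct)
  case (2 c m L)
  obtain A' B' where AB: "split_head L = (A', B')"
    by fastforce
  obtain t c' where c: "c = t # c'"
    using 2 by (cases c) auto
  have IH: "subset_sum w z K L = subset_sum w z K (lift1 B' @ lift0 A')" for K :: "'k list set"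
    using 2 AB by auto
  have ker_form_neg: "ker_form (Tp # tnegs c') = (ker_form (Tn # c') :: 'k list set)"
    using ker_form_tnorm[of "Tn # c'"] by simp
  show ?case
    using 2(3) by (cases t) (auto simp: AB c IH subset_sum_swap ker_form_neg)
qed auto

text \<open>A variable that no form involves ranges freely over three values, so every solution
  count is tripled.\<close>

lemma subset_sum_lift0:
  fixes K :: "'k list set"
  shows "subset_sum w z ((\<lambda>(x, a). x # a) ` (UNIV \<times> K)) (lift0 A) = subset_sum (\<lambda>c. w (3 * c)) z K A"
proof (induction A arbitrary: K)
  case Nil
  have "inj_on (\<lambda>(x::'k, a). x # a) (UNIV \<times> K)"
    by (auto simp: inj_on_def)
  then show ?case
    by (simp add: card_image card_cartesian_product card3)
next
  case (Cons b A)
  obtain c m where b: "b = (c, m)"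
    by fastforce
  have "(\<lambda>(x::'k, a). x # a) ` (UNIV \<times> K) \<inter> ker_form (Tz # c) = (\<lambda>(x, a). x # a) ` (UNIV \<times> (K \<inter> ker_form c))"
    by (auto simp: ker_form_def)
  then show ?case
    by (simp add: b Cons)
qed

text \<open>The solutions of \<open>x + c = 0\<close> over \<open>K\<close> form the graph of
  \<open>- c\<close>, which is in bijection with \<open>K\<close>. On this graph
  \<open>x + d\<close> becomes \<open>d - c\<close>, and forms without \<open>x\<close> are
  unchanged.\<close>

lemma subset_sum_subst:
  fixes K :: "'k list set"
  assumes "length c = n" "lengths n A" "lengths n B"
  shows "subset_sum w z ((\<lambda>a. (- dot (map tk c) a) # a) ` K) (lift1 B @ lift0 A)
       = subset_sum w z K (subst_tail c B @ A)"
  using assms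
proof (induction B arbitrary: K)
  case Nil
  then show ?case
  proof (induction A arbitrary: K)
    case Nil
    have "inj_on (\<lambda>a. (- dot (map tk c) a) # a) K"
      by (auto simp: inj_on_def)
    then show ?case
      by (simp add: card_image)
  next
    case (Cons b A)
    obtain d m where b: "b = (d, m)"
      by fastforce
    have "(\<lambda>a. (- dot (map tk c) a) # a) ` K \<inter> ker_form (Tz # d) = (\<lambda>a. (- dot (map tk c) a) # a) ` (K \<inter> ker_form d)"
      by (auto simp: ker_form_def)
    with Cons show ?case
      by (simp add: b)
  qed
next
  case (Cons b B)
  obtain d m where b: "b = (d, m)"
    by fastforce
  have "(\<lambda>a. (- dot (map tk c) a) # a) ` K \<inter> ker_form (Tp # d)
      = (\<lambda>a. (- dot (map tk c) a) # a) ` (K \<inter> ker_form (tsubs d c))"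
    using Cons.prems by (auto simp: ker_form_def b dot_tsubs)
  with Cons show ?case
    by (simp add: b)
qed

lemma kspace_Suc: "kspace (Suc n) = (\<lambda>(x, a). x # a) ` (UNIV \<times> (kspace n :: 'k list set))"
  by (auto simp: kspace_def length_Suc_conv image_iff)

lemma kspace_Int_ker_form:
  "kspace (Suc n) \<inter> ker_form (Tp # c) = (\<lambda>a. (- dot (map tk c) a) # a) ` (kspace n :: 'k list set)"
  by (auto simp: kspace_def ker_form_def length_Suc_conv image_iff add_eq_0_iff2)

lemma tree_val_put:
  fixes K :: "'k list set"
  shows "tree_val K w z (put s p t) = eval_bipoly z p (\<lambda>w. subset_sum w z K s) w + tree_val K w z t"
proof (induction s p t rule: put.induct)
  case (2 c m L p t)
  show ?case
  proof (cases "tzero c")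
    case True
    have *: "subset_sum w z K ((c, m) # L) = z ^ m * subset_sum w z K L" for w
      by (simp add: ker_form_tzero True algebra_simps)
    show ?thesis
      unfolding * eval_bipoly_mult by (simp add: True tree_val_tins eval_bipoly_bshift)
  qed (simp add: tree_val_tins del: subset_sum.simps)
qed (simp add: tree_val_tins)

lemma tree_val_contract:
  assumes "lengths n A" "lengths n B"
  shows "tree_val (kspace n :: 'k list set) w z (contract A p B t)
    = eval_bipoly z p (\<lambda>w. subset_sum w z (kspace (Suc n) :: 'k list set) (lift1 B @ lift0 A)) w + tree_val (kspace n :: 'k list set) w z t"
  using assms
proof (induction A p B t rule: contract.induct)
  case (1 A p t)
  then show ?case
    by (simp add: tree_val_put eval_bipoly_Nil_Cons kspace_Suc subset_sum_lift0 del: eval_bipoly.simps)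
next
  case (2 A p c m t)
  have "subset_sum w z ((\<lambda>a. (- dot (map tk c) a) # a) ` (kspace n :: 'k list set)) (lift0 A)
      = subset_sum w z (kspace n :: 'k list set) A" for w
    using subset_sum_subst[of c n A "[]" w z "kspace n"] 2 by simp
  then show ?case
    by (simp add: tree_val_put eval_bipoly_badd eval_bipoly_bmul eval_bipoly_Nil_Cons eval_bipoly_add_mult kspace_Int_ker_form del: eval_bipoly.simps)
      (simp add: kspace_Suc subset_sum_lift0)
next
  case (3 A p c m b B t)
  obtain d k where b: "b = (d, k)"
    by fastforce
  \<comment> \<open>The first summand deletes the form \<open>c\<close>; the second restricts to its
    kernel, parametrized as the graph of \<open>- c\<close>.\<close>
  have "subset_sum w z (kspace (Suc n) :: 'k list set) (lift1 ((c, m) # b # B) @ lift0 A)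
    = subset_sum w z (kspace (Suc n) :: 'k list set) (lift1 (b # B) @ lift0 A)
      + (z ^ m - 1) * subset_sum w z (kspace n :: 'k list set) (ins_all (subst_tail c (b # B)) A)" for w
    using subset_sum_subst[of c n A "b # B" w z "kspace n"] 3
    by (simp add: kspace_Int_ker_form subset_sum_ins_all)
  then show ?case
    using 3 by (simp add: tree_val_put eval_bipoly_bmul eval_bipoly_add_mult del: eval_bipoly.simps subset_sum.simps)
qed

lemma tree_val_step:
  assumes "tree_all (lengths (Suc n)) s"
  shows "tree_val (kspace n :: 'k list set) w z (step s t) = tree_val (kspace (Suc n) :: 'k list set) w z s + tree_val (kspace n :: 'k list set) w z t"
  using assms
proof (induction s t rule: step.induct)
  case (2 l s p r t)
  obtain A B where AB: "split_head s = (A, B)"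
    by fastforce
  have "lengths n A" "lengths n B"
    using lengths_split_head[OF _ AB] 2 by auto
  moreover have "subset_sum w z (kspace (Suc n) :: 'k list set) s
      = subset_sum w z (kspace (Suc n) :: 'k list set) (lift1 B @ lift0 A)" for w
    by (rule subset_sum_split_head[where n = n, OF _ AB]) (use 2 in simp)
  ultimately show ?case
    using 2 by (simp add: AB tree_val_contract)
qed auto

lemma tree_val_steps:
  "tree_all (lengths n) t \<Longrightarrow> tree_val (kspace 0 :: 'k list set) w z (steps n t) = tree_val (kspace n :: 'k list set) w z t"
  by (induction n t rule: steps.induct) (auto simp: tree_val_step tree_all_step)

text \<open>Once all variables are eliminated, only the empty arrangement on the one-point space
  \<open>kspace 0\<close> is left, hence \<open>w 1\<close>.\<close>

theorem subset_sum_steps: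
  assumes "steps n (put s [[1]] Lf) = Nd Lf [] P Lf" "lengths n s"
  shows "subset_sum w z (kspace n :: 'k list set) s = eval_bipoly z P (\<lambda>w. w 1) w"
  using tree_val_steps[of n "put s [[1]] Lf" w z] assms
  by (simp add: tree_val_put tree_all_put kspace_0)

end

section \<open>Quadratic forms in four variables\<close>

fun tmul :: "tri \<Rightarrow> tri \<Rightarrow> tri" where
  "tmul Tz _ = Tz" | "tmul Tp x = x" | "tmul Tn x = tneg x"

text \<open>
  This order of the monomials keeps the number of intermediate arrangements small (a few thousand for the
  pair of planes, which is the worst case).
\<close>

fun tver :: "tri \<times> tri \<times> tri \<times> tri \<Rightarrow> tri list" where
  "tver (x0, x1, x2, x3) = [tmul x0 x1, tmul x1 x1, tmul x1 x2, tmul x1 x3, tmul x2 x3,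
     tmul x2 x2, tmul x3 x3, tmul x0 x2, tmul x0 x3, tmul x0 x0]"

fun tdot :: "tri list \<Rightarrow> tri list \<Rightarrow> tri" where
  "tdot (a # x) (b # y) = tsub (tmul a b) (tneg (tdot x y))" | "tdot _ _ = Tz"

definition tri_all :: "tri list" where "tri_all = [Tz, Tp, Tn]"

text \<open>Representatives with first nonzero coordinate 1, listed by the position of this
  coordinate: 1 + 3 + 9 + 27 = 40.\<close>

definition tpoints :: "(tri \<times> tri \<times> tri \<times> tri) list" where
  "tpoints = (Tz, Tz, Tz, Tp) # map (\<lambda>d. (Tz, Tz, Tp, d)) tri_all
    @ concat (map (\<lambda>c. map (\<lambda>d. (Tz, Tp, c, d)) tri_all) tri_all)
    @ concat (map (\<lambda>b. concat (map (\<lambda>c. map (\<lambda>d. (Tp, b, c, d)) tri_all) tri_all)) tri_all)"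

definition tzeros :: "tri list \<Rightarrow> (tri \<times> tri \<times> tri \<times> tri) list" where
  "tzeros f = filter (\<lambda>x. tzero [tdot f (tver x)]) tpoints"

text \<open>Evaluation at a point is a linear form in the ten coefficients of a quadratic form. The
  points of the quadric thus become an arrangement in \<open>kspace 10\<close>.\<close>

definition zero_forms :: "tri list \<Rightarrow> arrangement" where
  "zero_forms f = ins_all (map (\<lambda>x. (tver x, 1)) (tzeros f)) []"

lemma distinct_tpoints: "distinct tpoints"
  by (simp add: tpoints_def tri_all_def)

fun tk4 :: "tri \<times> tri \<times> tri \<times> tri \<Rightarrow> 'k::field \<times> 'k \<times> 'k \<times> 'k" where
  "tk4 (a, b, c, d) = (tk a, tk b, tk c, tk d)"

fun kver :: "'k::field \<times> 'k \<times> 'k \<times> 'k \<Rightarrow> 'k list" where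
  "kver (x0, x1, x2, x3) =
    [x0 * x1, x1 * x1, x1 * x2, x1 * x3, x2 * x3, x2 * x2, x3 * x3, x0 * x2, x0 * x3, x0 * x0]"

definition qform :: "'k::field list \<Rightarrow> 'k \<times> 'k \<times> 'k \<times> 'k \<Rightarrow> 'k" where
  "qform a x = dot (kver x) a"

definition kpoints :: "('k::field \<times> 'k \<times> 'k \<times> 'k) set" where
  "kpoints = {(a, b, c, d). a = 1 \<or> a = 0 \<and> (b = 1 \<or> b = 0 \<and> (c = 1 \<or> c = 0 \<and> d = 1))}"

definition vanishing :: "('k::field \<times> 'k \<times> 'k \<times> 'k) set \<Rightarrow> 'k list set" where
  "vanishing J = {a \<in> kspace 10. \<forall>x\<in>J. qform a x = 0}"

definition quadric_zeros :: "'k::field list \<Rightarrow> ('k \<times> 'k \<times> 'k \<times> 'k) set" where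
  "quadric_zeros a = {x \<in> kpoints. qform a x = 0}"

text \<open>Here \<open>card (vanishing J)\<close> is the number \<open>W(J)\<close>. The weight
  \<open>w\<close> stays arbitrary, so that one evaluation per class of forms serves all dimensions
  of subcodes.\<close>

definition point_sum :: "(nat \<Rightarrow> 'r::comm_ring_1) \<Rightarrow> 'r \<Rightarrow> ('k::field \<times> 'k \<times> 'k \<times> 'k) set \<Rightarrow> 'r" where
  "point_sum w z S = (\<Sum>J\<in>Pow S. (z - 1) ^ card J * w (card (vanishing J)))"

definition linfun :: "('k::field \<times> 'k \<times> 'k \<times> 'k \<Rightarrow> 'k) \<Rightarrow> bool" where
  "linfun l \<longleftrightarrow> (\<exists>p q r s. \<forall>a b c d. l (a, b, c, d) = p * a + q * b + r * c + s * d)"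

lemma sum_Pow_insert:
  assumes "finite S" "x \<notin> S"
  shows "(\<Sum>J\<in>Pow (insert x S). F J) = (\<Sum>J\<in>Pow S. F J) + (\<Sum>J\<in>Pow S. F (insert x J))"
proof -
  have "inj_on (insert x) (Pow S)"
    using assms by (auto simp: inj_on_def)
  moreover have "Pow S \<inter> insert x ` Pow S = {}"
    using assms by auto
  ultimately show ?thesis
    using assms by (simp add: Pow_insert sum.union_disjoint sum.reindex o_def)
qed

lemma dot_commute: "dot a b = dot b a"
proof (induction a arbitrary: b)
  case Nil
  then show ?case by (cases b) auto
next
  case (Cons u a)
  then show ?case by (cases b) (auto simp: mult.commute)
qed

lemma qform_uminus: "qform a (- x) = qform a x"
  by (cases x) (simp add: qform_def)

lemma kspace_numeral:
  "a \<in> kspace 10 \<longleftrightarrow> (\<exists>a0 a1 a2 a3 a4 a5 a6 a7 a8 a9. a = [a0, a1, a2, a3, a4, a5, a6, a7, a8, a9])"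
proof
  assume "a \<in> kspace 10"
  then show "\<exists>a0 a1 a2 a3 a4 a5 a6 a7 a8 a9. a = [a0, a1, a2, a3, a4, a5, a6, a7, a8, a9]"
    unfolding kspace_def by (auto simp: numeral_eq_Suc length_Suc_conv)
qed (auto simp: kspace_def)

lemma qform_prod:
  assumes "linfun l" "linfun l'"
  shows "\<exists>a\<in>kspace 10. \<forall>x. qform a x = l x * l' x"
proof -
  obtain p q r s p' q' r' s' where l:
    "\<And>a b c d. l (a, b, c, d) = p * a + q * b + r * c + s * d"
    "\<And>a b c d. l' (a, b, c, d) = p' * a + q' * b + r' * c + s' * d"
    using assms by (auto simp: linfun_def)
  let ?d = "[p * q' + q * p', q * q', q * r' + r * q', q * s' + s * q', r * s' + s * r',
      r * r', s * s', p * r' + r * p', p * s' + s * p', p * p']"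
  have *: "\<forall>x. qform ?d x = l x * l' x"
    by (simp only: split_paired_All qform_def kver.simps dot.simps l distrib_left distrib_right mult.assoc
        add.assoc add_0_left add_0_right ac_simps simp_thms)
  have "?d \<in> kspace 10"
    by (simp add: kspace_def)
  with * show ?thesis
    by blast
qed

lemma qform_add:
  assumes "a \<in> kspace 10" "b \<in> kspace 10"
  shows "\<exists>d\<in>kspace 10. \<forall>x. qform d x = qform a x + u * qform b x"
proof -
  obtain a0 a1 a2 a3 a4 a5 a6 a7 a8 a9 where a: "a = [a0, a1, a2, a3, a4, a5, a6, a7, a8, a9]"
    using assms(1) unfolding kspace_numeral by blast
  obtain b0 b1 b2 b3 b4 b5 b6 b7 b8 b9 where b: "b = [b0, b1, b2, b3, b4, b5, b6, b7, b8, b9]"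
    using assms(2) unfolding kspace_numeral by blast
  let ?d = "[a0 + u * b0, a1 + u * b1, a2 + u * b2, a3 + u * b3, a4 + u * b4, a5 + u * b5,
      a6 + u * b6, a7 + u * b7, a8 + u * b8, a9 + u * b9]"
  have *: "\<forall>x. qform ?d x = qform a x + u * qform b x"
    by (simp only: split_paired_All qform_def kver.simps dot.simps a b distrib_left distrib_right
        add_0_left add_0_right ac_simps simp_thms)
  have "?d \<in> kspace 10"
    by (simp add: kspace_def)
  with * show ?thesis
    by blast
qed

text \<open>The substitution turns each of the ten monomials into a product of two linear functions,
  which is again a quadratic form by \<open>qform_prod\<close>.\<close>

lemma qform_comp:
  assumes "linfun l0" "linfun l1" "linfun l2" "linfun l3" "a \<in> kspace 10"
  shows "\<exists>b\<in>kspace 10. \<forall>x. qform b x = qform a (l0 x, l1 x, l2 x, l3 x)"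
proof -
  obtain a0 a1 a2 a3 a4 a5 a6 a7 a8 a9 where a: "a = [a0, a1, a2, a3, a4, a5, a6, a7, a8, a9]"
    using assms(5) unfolding kspace_numeral by blast
  have step: "\<exists>b\<in>kspace 10. \<forall>x. qform b x = F x + u * (l x * l' x)"
    if ex: "\<exists>b\<in>kspace 10. \<forall>x. qform b x = F x" and l: "linfun l" "linfun l'" for F u l l'
  proof -
    obtain b where "b \<in> kspace 10" "\<forall>x. qform b x = F x"
      using ex by blast
    moreover obtain d where "d \<in> kspace 10" "\<forall>x. qform d x = l x * l' x"
      using qform_prod[OF l] by blast
    ultimately show ?thesis
      using qform_add[of b d u] by simp
  qed
  have zero: "\<exists>b\<in>kspace 10. \<forall>x. qform b x = 0"
    by (rule bexI[of _ "[0, 0, 0, 0, 0, 0, 0, 0, 0, 0]"]) (auto simp: qform_def kspace_def)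
  have "qform a (l0 x, l1 x, l2 x, l3 x) = 0 + a0 * (l0 x * l1 x) + a1 * (l1 x * l1 x)
     + a2 * (l1 x * l2 x) + a3 * (l1 x * l3 x) + a4 * (l2 x * l3 x) + a5 * (l2 x * l2 x)
     + a6 * (l3 x * l3 x) + a7 * (l0 x * l2 x) + a8 * (l0 x * l3 x) + a9 * (l0 x * l0 x)" for x
    by (simp only: a qform_def kver.simps dot.simps add_0_left add_0_right ac_simps)
  \<comment> \<open>Each use of \<open>step\<close> adds one of the ten products, starting from the
    zero form.\<close>
  then show ?thesis
    by (simp only:) (rule step step step step step step step step step step zero assms)+
qed

lemma linfunI: "(\<And>a b c d. l (a, b, c, d) = p * a + q * b + r * c + s * d) \<Longrightarrow> linfun l"
  unfolding linfun_def by blast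

lemma linfun_uminus: "linfun l \<Longrightarrow> l (- x) = - l x"
  by (cases x) (auto simp: linfun_def)

context ternary
begin

lemma tk_tmul: "tk (tmul s t) = (tk s * tk t :: 'k)"
  by (cases s) (auto simp: tk_tneg)

lemma tk_tdot: "tk (tdot a b) = (dot (map tk a) (map tk b) :: 'k)"
  by (induction a b rule: tdot.induct) (auto simp: tk_tsub tk_tneg tk_tmul)

lemma map_tk_tver: "map tk (tver t) = (kver (tk4 t) :: 'k list)"
  by (cases t) (simp add: tk_tmul)

lemma tk_inject: "(tk s :: 'k) = tk t \<longleftrightarrow> s = t"
  using neg_one_neq_one neg_one_neq_one[symmetric] by (cases s; cases t) auto

lemma tk4_inject: "(tk4 s :: 'k \<times> 'k \<times> 'k \<times> 'k) = tk4 t \<longleftrightarrow> s = t"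
  by (cases s; cases t) (simp add: tk_inject)

lemma range_tk: "\<exists>t. x = (tk t :: 'k)"
  using k_cases[of x] by (metis tk.simps)

lemma kpoints_eq: "kpoints = (tk4 ` set tpoints :: ('k \<times> 'k \<times> 'k \<times> 'k) set)"
proof -
  have "set tpoints = {(a, b, c, d). a = Tp \<or> a = Tz \<and> (b = Tp \<or> b = Tz \<and> (c = Tp \<or> c = Tz \<and> d = Tp))}"
    (is "_ = ?T")
  proof (rule set_eqI)
    fix x :: "tri \<times> tri \<times> tri \<times> tri"
    obtain a b c d where "x = (a, b, c, d)"
      by (cases x)
    then show "x \<in> set tpoints \<longleftrightarrow> x \<in> ?T"
      by (cases a; cases b; cases c; cases d) (simp_all add: tpoints_def tri_all_def)
  qed
  moreover have "tk4 ` ?T = (kpoints :: ('k \<times> 'k \<times> 'k \<times> 'k) set)"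
  proof (intro equalityI subsetI)
    fix x :: "'k \<times> 'k \<times> 'k \<times> 'k"
    assume x: "x \<in> kpoints"
    obtain a b c d where "x = (tk a, tk b, tk c, tk d)"
      using range_tk by (metis prod.exhaust)
    then have "x = tk4 (a, b, c, d)" "(a, b, c, d) \<in> ?T"
      using x tk_inject[of _ Tz] tk_inject[of _ Tp] by (auto simp: kpoints_def)
    then show "x \<in> tk4 ` ?T"
      by blast
  qed (auto simp: kpoints_def)
  ultimately show ?thesis
    by simp
qed

lemma finite_kpoints [simp]: "finite (kpoints :: ('k \<times> 'k \<times> 'k \<times> 'k) set)"
  by (simp add: kpoints_eq)

lemma card_kpoints: "card (kpoints :: ('k \<times> 'k \<times> 'k \<times> 'k) set) = 40"
proof -
  have "card (kpoints :: ('k \<times> 'k \<times> 'k \<times> 'k) set) = card (set tpoints)"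
    unfolding kpoints_eq by (rule card_image) (simp add: inj_on_def tk4_inject)
  also have "\<dots> = 40"
    using distinct_tpoints by (simp add: distinct_card) (simp add: tpoints_def tri_all_def)
  finally show ?thesis .
qed

text \<open>The units are 1 and -1, so exactly one of \<open>x\<close> and \<open>- x\<close> has 1
  as its first nonzero coordinate.\<close>

lemma kpoints_uminus:
  fixes x :: "'k \<times> 'k \<times> 'k \<times> 'k"
  assumes "x \<noteq> 0"
  shows "- x \<in> kpoints \<longleftrightarrow> x \<notin> kpoints"
proof -
  have sgn: "- u = 1 \<longleftrightarrow> u \<noteq> 1" if "u \<noteq> 0" for u :: 'k
    using that k_cases[of u] neg_one_neq_one by auto
  obtain a b c d where x: "x = (a, b, c, d)"
    by (cases x)
  show ?thesis
    using assms sgn[of a] sgn[of b] sgn[of c] sgn[of d]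
    by (cases "a = 0"; cases "b = 0"; cases "c = 0") (simp_all add: x kpoints_def zero_prod_def)
qed

lemma zero_notin_kpoints: "(0 :: 'k \<times> 'k \<times> 'k \<times> 'k) \<notin> kpoints"
  by (simp add: kpoints_def zero_prod_def)

lemma finite_kspace [simp]: "finite (kspace n :: 'k list set)"
  using finite_lists_length_eq[of "UNIV :: 'k set" n] by (simp add: kspace_def)

text \<open>All multiplicities are 1, so a choice of forms is a set \<open>J\<close> of points and
  contributes \<open>z - 1\<close> for each of its elements.\<close>

lemma subset_sum_tver:
  fixes K :: "'k list set"
  assumes "distinct ts"
  shows "subset_sum w z K (map (\<lambda>t. (tver t, 1)) ts)
    = (\<Sum>J\<in>Pow (tk4 ` set ts). (z - 1) ^ card J * w (card {a \<in> K. \<forall>x\<in>J. qform a x = 0}))"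
  using assms
proof (induction ts arbitrary: K)
  case (Cons t ts)
  let ?x = "tk4 t :: 'k \<times> 'k \<times> 'k \<times> 'k"
  let ?S = "tk4 ` set ts :: ('k \<times> 'k \<times> 'k \<times> 'k) set"
  have x: "?x \<notin> ?S"
    using Cons.prems by (simp add: image_iff tk4_inject)
  have ker_form: "K \<inter> ker_form (tver t) = {a \<in> K. qform a ?x = 0}"
    by (auto simp: ker_form_def map_tk_tver qform_def)
  have "(z - 1) ^ card (insert ?x J) * w (card {a \<in> K. \<forall>x\<in>insert ?x J. qform a x = 0})
      = (z - 1) * ((z - 1) ^ card J * w (card {a \<in> K \<inter> ker_form (tver t). \<forall>x\<in>J. qform a x = 0}))"
    if "J \<in> Pow ?S" for J
  proof -
    have "finite J" "?x \<notin> J"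
      using that x by (auto intro: finite_subset)
    moreover have "{a \<in> K. \<forall>x\<in>insert ?x J. qform a x = 0} = {a \<in> K \<inter> ker_form (tver t). \<forall>x\<in>J. qform a x = 0}"
      by (auto simp: ker_form)
    ultimately show ?thesis
      by (simp add: mult.assoc)
  qed
  then show ?case
    using Cons x by (simp add: sum_Pow_insert sum_distrib_left)
qed simp

lemma quadric_zeros_eq: "quadric_zeros (map tk f) = (tk4 ` set (tzeros f) :: ('k \<times> 'k \<times> 'k \<times> 'k) set)"
proof -
  have "tzero [tdot f (tver t)] \<longleftrightarrow> tdot f (tver t) = Tz" for t
    by (cases "tdot f (tver t)") auto
  moreover have "tdot f (tver t) = Tz \<longleftrightarrow> qform (map tk f) (tk4 t) = (0 :: 'k)" for t
    using tk_tdot[of f "tver t"] tk_inject[of "tdot f (tver t)" Tz]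
    by (simp add: qform_def map_tk_tver dot_commute)
  ultimately show ?thesis
    by (auto simp: quadric_zeros_def kpoints_eq tzeros_def)
qed

lemma point_sum_quadric_zeros:
  assumes "steps 10 (put (zero_forms f) [[1]] Lf) = Nd Lf [] P Lf"
  shows "point_sum w z (quadric_zeros (map tk f) :: ('k \<times> 'k \<times> 'k \<times> 'k) set) = eval_bipoly z P (\<lambda>w. w 1) w"
proof -
  have len: "lengths 10 (map (\<lambda>t. (tver t, Suc 0)) ts)" for ts
    by (auto simp: lengths_def)
  have "distinct (tzeros f)"
    by (simp add: tzeros_def distinct_tpoints)
  then have "point_sum w z (quadric_zeros (map tk f) :: ('k \<times> 'k \<times> 'k \<times> 'k) set) = subset_sum w z (kspace 10 :: 'k list set) (zero_forms f)"
    using subset_sum_tver[of "tzeros f" w z "kspace 10"]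
    by (simp add: point_sum_def quadric_zeros_eq vanishing_def zero_forms_def subset_sum_ins_all)
  also have "\<dots> = eval_bipoly z P (\<lambda>w. w 1) w"
    using assms by (rule subset_sum_steps) (simp add: zero_forms_def len)
  finally show ?thesis .
qed

text \<open>Ten points suffice: the unit vectors give the coefficients of the squares, and then the
  sums of two unit vectors give the mixed coefficients.\<close>

lemma qform_inj:
  fixes a b :: "'k list"
  assumes "a \<in> kspace 10" "b \<in> kspace 10" and eq: "\<And>x. x \<in> kpoints \<Longrightarrow> qform a x = qform b x"
  shows "a = b"
proof -
  obtain a0 a1 a2 a3 a4 a5 a6 a7 a8 a9 where a: "a = [a0, a1, a2, a3, a4, a5, a6, a7, a8, a9]"
    using assms(1) unfolding kspace_numeral by blast
  obtain b0 b1 b2 b3 b4 b5 b6 b7 b8 b9 where b: "b = [b0, b1, b2, b3, b4, b5, b6, b7, b8, b9]"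
    using assms(2) unfolding kspace_numeral by blast
  have diag: "a9 = b9" "a1 = b1" "a5 = b5" "a6 = b6"
    using eq[of "(1, 0, 0, 0)"] eq[of "(0, 1, 0, 0)"] eq[of "(0, 0, 1, 0)"] eq[of "(0, 0, 0, 1)"]
    by (simp_all add: a b qform_def kpoints_def)
  have "a0 = b0" "a7 = b7" "a8 = b8" "a2 = b2" "a3 = b3" "a4 = b4"
    using eq[of "(1, 1, 0, 0)"] eq[of "(1, 0, 1, 0)"] eq[of "(1, 0, 0, 1)"]
      eq[of "(0, 1, 1, 0)"] eq[of "(0, 1, 0, 1)"] eq[of "(0, 0, 1, 1)"]
    by (simp_all add: a b qform_def kpoints_def diag)
  with diag show ?thesis
    by (simp add: a b)
qed

end

section \<open>Invariance under linear substitutions\<close>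

definition quad :: "'k::field \<Rightarrow> 'k \<Rightarrow> 'k \<Rightarrow> 'k \<Rightarrow> 'k \<Rightarrow> 'k \<Rightarrow> 'k \<Rightarrow> 'k \<Rightarrow> 'k \<Rightarrow> 'k
    \<Rightarrow> 'k \<Rightarrow> 'k \<Rightarrow> 'k \<Rightarrow> 'k \<Rightarrow> 'k" where
  "quad a b1 b2 b3 c11 c12 c13 c22 c23 c33 x0 x1 x2 x3 =
    a * x0 * x0 + b1 * x0 * x1 + b2 * x0 * x2 + b3 * x0 * x3 + c11 * x1 * x1 + c12 * x1 * x2
    + c13 * x1 * x3 + c22 * x2 * x2 + c23 * x2 * x3 + c33 * x3 * x3"

text \<open>The arguments run through the upper triangle of the form row by row, whereas the list
  follows the order of monomials in \<open>kver\<close>.\<close>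

definition quad_sum :: "(nat \<Rightarrow> 'r::comm_ring_1) \<Rightarrow> 'r \<Rightarrow> 'k::field \<Rightarrow> 'k \<Rightarrow> 'k \<Rightarrow> 'k \<Rightarrow> 'k \<Rightarrow> 'k \<Rightarrow> 'k
    \<Rightarrow> 'k \<Rightarrow> 'k \<Rightarrow> 'k \<Rightarrow> 'r" where
  "quad_sum w z a b1 b2 b3 c11 c12 c13 c22 c23 c33 = point_sum w z (quadric_zeros [b1, c11, c12, c13, c23, c22, c33, b2, b3, a])"

lemma qform_quad:
  "qform [b1, c11, c12, c13, c23, c22, c33, b2, b3, a] (x0, x1, x2, x3)
    = quad a b1 b2 b3 c11 c12 c13 c22 c23 c33 x0 x1 x2 x3"
  by (simp only: qform_def quad_def kver.simps dot.simps add_0_right add_0_left ac_simps)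

context ternary
begin

text \<open>An injective linear substitution permutes the projective points and, by pullback, the
  quadratic forms. It therefore carries one zero set onto the other and preserves the number of
  forms that vanish on a set of points. The nonzero scalar \<open>e\<close> does not move any
  zeros.\<close>

lemma point_sum_comp:
  fixes a b :: "'k list" and g :: "'k \<times> 'k \<times> 'k \<times> 'k \<Rightarrow> 'k \<times> 'k \<times> 'k \<times> 'k"
  assumes lin: "linfun l0" "linfun l1" "linfun l2" "linfun l3"
    and g_def: "g = (\<lambda>x. (l0 x, l1 x, l2 x, l3 x))" and "inj g"
    and e: "e \<noteq> 0" and b: "\<And>x. qform b x = e * qform a (g x)"
  shows "point_sum w z (quadric_zeros b) = point_sum w z (quadric_zeros a)"
proof -
  have g_uminus: "g (- x) = - g x" for x
    by (simp add: g_def linfun_uminus lin)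
  have "g 0 = 0"
    using lin by (auto simp: g_def linfun_def zero_prod_def)
  then have g_nz: "g x \<noteq> 0" if "x \<in> kpoints" for x
    using that zero_notin_kpoints \<open>inj g\<close> by (metis injD)
  \<comment> \<open>\<open>g\<close> may send a normalized representative to the negative of one.
    The sign is corrected here; quadratic forms do not see it.\<close>
  define h where "h x = (if g x \<in> kpoints then g x else - g x)" for x
  have h: "h x \<in> kpoints" if "x \<in> kpoints" for x
    using kpoints_uminus[OF g_nz[OF that]] by (simp add: h_def)
  have qform_h: "qform c (h x) = qform c (g x)" for c x
    by (simp add: h_def qform_uminus)
  have inj_h: "inj_on h kpoints"
  proof (rule inj_onI)
    fix x y assume xy: "x \<in> kpoints" "y \<in> kpoints" "h x = h y"
    then have "g x = g y \<or> g x = - g y"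
      by (auto simp: h_def split: if_splits) (metis minus_minus)+
    then have "g x = g y \<or> g x = g (- y)"
      by (simp add: g_uminus)
    then have "x = y \<or> x = - y"
      using \<open>inj g\<close> by (auto dest: injD)
    moreover have "y \<noteq> 0"
      using xy zero_notin_kpoints by auto
    ultimately show "x = y"
      using xy kpoints_uminus[of y] by auto
  qed
  have surj_h: "h ` kpoints = kpoints"
    using h inj_h by (intro endo_inj_surj) auto
  have quadric_zeros: "quadric_zeros a = h ` quadric_zeros b"
  proof (intro equalityI subsetI)
    fix y assume y: "y \<in> quadric_zeros a"
    then have "y \<in> h ` kpoints"
      by (simp add: surj_h quadric_zeros_def)
    then obtain x where "x \<in> kpoints" "y = h x"
      by blast
    with y show "y \<in> h ` quadric_zeros b"
      by (auto simp: quadric_zeros_def b qform_h)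
  next
    fix y assume "y \<in> h ` quadric_zeros b"
    then show "y \<in> quadric_zeros a"
      using e by (auto simp: quadric_zeros_def b qform_h h)
  qed
  have inj_quadric_zeros: "inj_on h (quadric_zeros b)"
    using inj_h by (rule inj_on_subset) (auto simp: quadric_zeros_def)
  \<comment> \<open>\<open>T\<close> is the pullback along \<open>g\<close>. It is injective because
    \<open>h\<close> reaches every point and the points determine the form.\<close>
  have "\<exists>d\<in>kspace 10. \<forall>x. qform d x = qform c (g x)" if "c \<in> kspace 10" for c
    unfolding g_def using lin that by (rule qform_comp)
  then obtain T where T: "\<And>c. c \<in> kspace 10 \<Longrightarrow> T c \<in> kspace 10"
    and qf_T: "\<And>c x. c \<in> kspace 10 \<Longrightarrow> qform (T c) x = qform c (g x)"
    by metis
  have inj_T: "inj_on T (kspace 10)"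
  proof (rule inj_onI)
    fix c d assume cd: "c \<in> kspace 10" "d \<in> kspace 10" "T c = T d"
    show "c = d"
    proof (rule qform_inj[OF cd(1,2)])
      fix y :: "'k \<times> 'k \<times> 'k \<times> 'k" assume "y \<in> kpoints"
      then obtain x where "y = h x"
        using surj_h by blast
      then show "qform c y = qform d y"
        using cd qf_T by (metis qform_h)
    qed
  qed
  have surj_T: "T ` kspace 10 = kspace 10"
    using T inj_T by (intro endo_inj_surj) auto
  have card_van: "card (vanishing (h ` J)) = card (vanishing J)" for J
  proof -
    have "vanishing J = T ` vanishing (h ` J)"
    proof (intro equalityI subsetI)
      fix d assume d: "d \<in> vanishing J"
      then obtain c where "c \<in> kspace 10" "d = T c"
        using surj_T by (auto simp: vanishing_def)
      with d show "d \<in> T ` vanishing (h ` J)"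
        by (auto simp: vanishing_def qf_T qform_h)
    next
      fix d assume "d \<in> T ` vanishing (h ` J)"
      then show "d \<in> vanishing J"
        by (auto simp: vanishing_def qf_T qform_h T)
    qed
    moreover have "inj_on T (vanishing (h ` J))"
      using inj_T by (rule inj_on_subset) (auto simp: vanishing_def)
    ultimately show ?thesis
      by (simp add: card_image)
  qed
  have "point_sum w z (quadric_zeros a) = (\<Sum>J\<in>image h ` Pow (quadric_zeros b). (z - 1) ^ card J * w (card (vanishing J)))"
    by (simp add: point_sum_def quadric_zeros image_Pow_surj)
  also have "\<dots> = (\<Sum>J\<in>Pow (quadric_zeros b). (z - 1) ^ card (h ` J) * w (card (vanishing (h ` J))))"
    by (subst sum.reindex) (auto intro!: inj_on_image_Pow inj_quadric_zeros)
  also have "\<dots> = point_sum w z (quadric_zeros b)"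
    unfolding point_sum_def card_van
  proof (intro sum.cong refl)
    fix J assume "J \<in> Pow (quadric_zeros b)"
    then have "inj_on h J"
      using inj_quadric_zeros by (meson PowD inj_on_subset)
    then show "(z - 1) ^ card (h ` J) * w (card (vanishing J)) = (z - 1) ^ card J * w (card (vanishing J))"
      by (simp add: card_image)
  qed
  finally show ?thesis
    by simp
qed

text \<open>The premise \<open>ker\<close> says that the substitution matrix has trivial kernel,
  which gives the injectivity required by \<open>point_sum_comp\<close>.\<close>

lemma quad_sum_lin:
  fixes m00 :: 'k
  assumes ker: "\<And>x0 x1 x2 x3. m00 * x0 + m01 * x1 + m02 * x2 + m03 * x3 = 0 \<Longrightarrow>
      m10 * x0 + m11 * x1 + m12 * x2 + m13 * x3 = 0 \<Longrightarrow>
      m20 * x0 + m21 * x1 + m22 * x2 + m23 * x3 = 0 \<Longrightarrow>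
      m30 * x0 + m31 * x1 + m32 * x2 + m33 * x3 = 0 \<Longrightarrow> x0 = 0 \<and> x1 = 0 \<and> x2 = 0 \<and> x3 = 0"
    and e: "e \<noteq> 0"
    and eq: "\<And>x0 x1 x2 x3. quad a' b1' b2' b3' c11' c12' c13' c22' c23' c33' x0 x1 x2 x3
      = e * quad a b1 b2 b3 c11 c12 c13 c22 c23 c33
         (m00 * x0 + m01 * x1 + m02 * x2 + m03 * x3) (m10 * x0 + m11 * x1 + m12 * x2 + m13 * x3)
         (m20 * x0 + m21 * x1 + m22 * x2 + m23 * x3) (m30 * x0 + m31 * x1 + m32 * x2 + m33 * x3)"
  shows "quad_sum w z a b1 b2 b3 c11 c12 c13 c22 c23 c33 = quad_sum w z a' b1' b2' b3' c11' c12' c13' c22' c23' c33'"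
  unfolding quad_sum_def
proof (rule point_sum_comp[symmetric])
  let ?l = "\<lambda>p q r s :: 'k. \<lambda>(x0, x1, x2, x3). p * x0 + q * x1 + r * x2 + s * x3"
  show lin: "linfun (?l m00 m01 m02 m03)" "linfun (?l m10 m11 m12 m13)"
    "linfun (?l m20 m21 m22 m23)" "linfun (?l m30 m31 m32 m33)"
    by (rule linfunI, rule prod.case[THEN trans], simp only: prod.case)+
  let ?g = "\<lambda>x. (?l m00 m01 m02 m03 x, ?l m10 m11 m12 m13 x, ?l m20 m21 m22 m23 x, ?l m30 m31 m32 m33 x)"
  show "inj ?g"
  proof (rule injI)
    fix x y assume *: "?g x = ?g y"
    obtain x0 x1 x2 x3 y0 y1 y2 y3 where xy: "x = (x0, x1, x2, x3)" "y = (y0, y1, y2, y3)"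
      by (cases x; cases y)
    have diff: "p * (x0 - y0) + q * (x1 - y1) + r * (x2 - y2) + s * (x3 - y3) = 0"
      if "p * x0 + q * x1 + r * x2 + s * x3 = p * y0 + q * y1 + r * y2 + s * y3" for p q r s
      using that by (simp add: right_diff_distrib) (simp add: algebra_simps)
    have "x0 - y0 = 0 \<and> x1 - y1 = 0 \<and> x2 - y2 = 0 \<and> x3 - y3 = 0"
      by (rule ker; rule diff) (use * in \<open>simp_all add: xy\<close>)
    then show "x = y"
      by (simp add: xy)
  qed
  show "?g = ?g" ..
  show "e \<noteq> 0"
    by fact
  fix x :: "'k \<times> 'k \<times> 'k \<times> 'k"
  obtain x0 x1 x2 x3 where x: "x = (x0, x1, x2, x3)"
    by (cases x)
  show "qform [b1', c11', c12', c13', c23', c22', c33', b2', b3', a'] x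
    = e * qform [b1, c11, c12, c13, c23, c22, c33, b2, b3, a] (?g x)"
    by (simp only: x prod.case qform_quad eq)
qed

section \<open>Diagonalization of quadratic forms in characteristic three\<close>

lemma uminus_double: "- (x :: 'k) = x + x"
  by (simp only: add_self)

lemma triple_left: "(x :: 'k) + (x + (x + y)) = y"
proof -
  have "x + (x + (x + y)) = (x + x) + (x + y)"
    by (simp only: add.assoc)
  then show ?thesis
    by (simp only: add_self minus_add_cancel)
qed

lemma triple: "(x :: 'k) + (x + x) = 0"
  by (simp only: add_self right_minus)

text \<open>Normalizes polynomials in characteristic three: negation becomes doubling, products are
  expanded, sorting brings equal monomials together, and triples cancel.\<close>

lemmas k3_simps = diff_conv_add_uminus uminus_double distrib_left distrib_right mult_1_left mult_1_right
  mult_zero_left mult_zero_right add_0_left add_0_right triple triple_left ac_simps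

lemma square_one_cases: "(a :: 'k) * a = 1 \<Longrightarrow> a = 1 \<or> a = - 1"
  using k_cases[of a] by auto

text \<open>Completing the square. Modulo 3 the factor -1/2 is 1 and \<open>a\<close> is its own
  inverse, so \<open>x0\<close> is replaced by
  \<open>x0 + a * (b1 * x1 + b2 * x2 + b3 * x3)\<close>. Inserting the two possible values of
  \<open>a\<close> leaves identities that \<open>k3_simps\<close> can check.\<close>

lemma quad_sum_pivot0:
  fixes a b c c22 c33 :: 'k
  assumes "a * a = 1"
  shows "quad_sum w z a b1 b2 b3 c11 c12 c13 c22 c23 c33
    = quad_sum w z a 0 0 0 (c11 - a * b1 * b1) (c12 + a * b1 * b2) (c13 + a * b1 * b3) (c22 - a * b2 * b2) (c23 + a * b2 * b3) (c33 - a * b3 * b3)"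
  using square_one_cases[OF assms]
proof (elim disjE)
  assume *: "a = 1"
  \<comment> \<open>In this and the following uses of \<open>quad_sum_lin\<close>, the first sixteen
    instances are the rows of the substitution matrix and the last is the scalar
    \<open>e\<close>.\<close>
  show ?thesis
    unfolding *
    by (rule quad_sum_lin[of "1" "1 * b1" "1 * b2" "1 * b3" "0" "1" "0" "0" "0" "0" "1" "0" "0" "0" "0" "1" "1"],
        force simp: add_eq_0_iff, simp, simp only: quad_def k3_simps)
next
  assume *: "a = - 1"
  show ?thesis
    unfolding *
    by (rule quad_sum_lin[of "1" "(- 1) * b1" "(- 1) * b2" "(- 1) * b3" "0" "1" "0" "0" "0" "0" "1" "0" "0" "0" "0" "1" "1"],
        force simp: add_eq_0_iff, simp, simp only: quad_def k3_simps)
qed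

lemma quad_sum_pivot1:
  fixes a b c c22 c33 :: 'k
  assumes "c * c = 1"
  shows "quad_sum w z a 0 0 0 c c12 c13 c22 c23 c33
    = quad_sum w z a 0 0 0 c 0 0 (c22 - c * c12 * c12) (c23 + c * c12 * c13) (c33 - c * c13 * c13)"
  using square_one_cases[OF assms]
proof (elim disjE)
  assume *: "c = 1"
  show ?thesis
    unfolding *
    by (rule quad_sum_lin[of "1" "0" "0" "0" "0" "1" "1 * c12" "1 * c13" "0" "0" "1" "0" "0" "0" "0" "1" "1"],
        force simp: add_eq_0_iff, simp, simp only: quad_def k3_simps)
next
  assume *: "c = - 1"
  show ?thesis
    unfolding *
    by (rule quad_sum_lin[of "1" "0" "0" "0" "0" "1" "(- 1) * c12" "(- 1) * c13" "0" "0" "1" "0" "0" "0" "0" "1" "1"],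
        force simp: add_eq_0_iff, simp, simp only: quad_def k3_simps)
qed

lemma quad_sum_pivot2:
  fixes a b c c22 c33 :: 'k
  assumes "c * c = 1"
  shows "quad_sum w z a 0 0 0 b 0 0 c c23 c33
    = quad_sum w z a 0 0 0 b 0 0 c 0 (c33 - c * c23 * c23)"
  using square_one_cases[OF assms]
proof (elim disjE)
  assume *: "c = 1"
  show ?thesis
    unfolding *
    by (rule quad_sum_lin[of "1" "0" "0" "0" "0" "1" "0" "0" "0" "0" "1" "1 * c23" "0" "0" "0" "1" "1"],
        force simp: add_eq_0_iff, simp, simp only: quad_def k3_simps)
next
  assume *: "c = - 1"
  show ?thesis
    unfolding *
    by (rule quad_sum_lin[of "1" "0" "0" "0" "0" "1" "0" "0" "0" "0" "1" "(- 1) * c23" "0" "0" "0" "1" "1"],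
        force simp: add_eq_0_iff, simp, simp only: quad_def k3_simps)
qed

text \<open>Without a square of \<open>x0\<close>, a nonzero coefficient of \<open>x0 * x1\<close>
  splits off a hyperbolic plane: shifting \<open>x0\<close> and \<open>x1\<close> absorbs all other
  monomials in which they occur.\<close>

lemma quad_sum_hyp0:
  fixes a b c c22 c33 :: 'k
  assumes "b * b = 1"
  shows "quad_sum w z 0 b b2 b3 c11 c12 c13 c22 c23 c33
    = quad_sum w z 0 1 0 0 0 0 0 (c22 + (b2 * b2 * c11 - b * b2 * c12)) (c23 + (- b2 * b3 * c11 - b * b3 * c12 - b * b2 * c13)) (c33 + (b3 * b3 * c11 - b * b3 * c13))"
  using square_one_cases[OF assms]
proof (elim disjE)
  assume *: "b = 1"
  show ?thesis
    unfolding *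
    by (rule quad_sum_lin[of "1" "- c11" "- (1 * c12 + c11 * b2)" "- (1 * c13 + c11 * b3)" "0" "1" "- 1 * b2" "- 1 * b3" "0" "0" "1" "0" "0" "0" "0" "1" "1"],
        force simp: add_eq_0_iff, simp, simp only: quad_def k3_simps)
next
  assume *: "b = - 1"
  show ?thesis
    unfolding *
    by (rule quad_sum_lin[of "1" "- c11" "- ((- 1) * c12 + c11 * b2)" "- ((- 1) * c13 + c11 * b3)" "0" "(- 1)" "- (- 1) * b2" "- (- 1) * b3" "0" "0" "1" "0" "0" "0" "0" "1" "1"],
        force simp: add_eq_0_iff, simp, simp only: quad_def k3_simps)
qed

lemma quad_sum_swap12:
  fixes a b c c22 c33 :: 'k
  shows "quad_sum w z a b1 b2 b3 c11 c12 c13 c22 c23 c33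
    = quad_sum w z a b2 b1 b3 c22 c12 c23 c11 c13 c33"
  by (rule quad_sum_lin[of "1" "0" "0" "0" "0" "0" "1" "0" "0" "1" "0" "0" "0" "0" "0" "1" "1"],
      force simp: add_eq_0_iff, simp, simp only: quad_def k3_simps)

lemma quad_sum_swap13:
  fixes a b c c22 c33 :: 'k
  shows "quad_sum w z a b1 b2 b3 c11 c12 c13 c22 c23 c33
    = quad_sum w z a b3 b2 b1 c33 c23 c13 c22 c12 c11"
  by (rule quad_sum_lin[of "1" "0" "0" "0" "0" "0" "0" "1" "0" "0" "1" "0" "0" "1" "0" "0" "1"],
      force simp: add_eq_0_iff, simp, simp only: quad_def k3_simps)

lemma quad_sum_swap23:
  fixes a b c c22 c33 :: 'k
  shows "quad_sum w z a b1 b2 b3 c11 c12 c13 c22 c23 c33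
    = quad_sum w z a b1 b3 b2 c11 c13 c12 c33 c23 c22"
  by (rule quad_sum_lin[of "1" "0" "0" "0" "0" "1" "0" "0" "0" "0" "0" "1" "0" "0" "1" "0" "1"],
      force simp: add_eq_0_iff, simp, simp only: quad_def k3_simps)

lemma quad_sum_swap01:
  fixes a b c c22 c33 :: 'k
  shows "quad_sum w z a b1 b2 b3 c11 c12 c13 c22 c23 c33
    = quad_sum w z c11 b1 c12 c13 a b2 b3 c22 c23 c33"
  by (rule quad_sum_lin[of "0" "1" "0" "0" "1" "0" "0" "0" "0" "0" "1" "0" "0" "0" "0" "1" "1"],
      force simp: add_eq_0_iff, simp, simp only: quad_def k3_simps)

lemma quad_sum_hyp1:
  fixes a b c c22 c33 :: 'k
  assumes "c * c = 1"
  shows "quad_sum w z a 0 0 0 0 c c13 c22 c23 c33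
    = quad_sum w z a 0 0 0 0 1 0 0 0 (c33 + (c13 * c13 * c22 - c * c13 * c23))"
  using square_one_cases[OF assms]
proof (elim disjE)
  assume *: "c = 1"
  show ?thesis
    unfolding *
    by (rule quad_sum_lin[of "1" "0" "0" "0" "0" "1" "- c22" "- (1 * c23 + c22 * c13)" "0" "0" "1" "- 1 * c13" "0" "0" "0" "1" "1"],
        force simp: add_eq_0_iff, simp, simp only: quad_def k3_simps)
next
  assume *: "c = - 1"
  show ?thesis
    unfolding *
    by (rule quad_sum_lin[of "1" "0" "0" "0" "0" "1" "- c22" "- ((- 1) * c23 + c22 * c13)" "0" "0" "(- 1)" "- (- 1) * c13" "0" "0" "0" "1" "1"],
        force simp: add_eq_0_iff, simp, simp only: quad_def k3_simps)
qed

lemma quad_sum_hyp2: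
  fixes a b c c22 c33 :: 'k
  assumes "c * c = 1"
  shows "quad_sum w z a 0 0 0 b 0 0 0 c c33
    = quad_sum w z a 0 0 0 b 0 0 0 1 0"
  using square_one_cases[OF assms]
proof (elim disjE)
  assume *: "c = 1"
  show ?thesis
    unfolding *
    by (rule quad_sum_lin[of "1" "0" "0" "0" "0" "1" "0" "0" "0" "0" "1" "- 1 * c33" "0" "0" "0" "1" "1"],
        force simp: add_eq_0_iff, simp, simp only: quad_def k3_simps)
next
  assume *: "c = - 1"
  show ?thesis
    unfolding *
    by (rule quad_sum_lin[of "1" "0" "0" "0" "0" "1" "0" "0" "0" "0" "(- 1)" "- (- 1) * c33" "0" "0" "0" "1" "1"],
        force simp: add_eq_0_iff, simp, simp only: quad_def k3_simps)
qed

text \<open>Replacing \<open>x0\<close> by \<open>x0 + x1\<close> and \<open>x1\<close> by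
  \<open>x0 - x1\<close> turns the product \<open>x0 * x1\<close> into a difference of
  squares.\<close>

lemma quad_sum_split0:
  fixes a b c c22 c33 :: 'k
  shows "quad_sum w z 0 1 0 0 0 0 0 c22 c23 c33
    = quad_sum w z 1 0 0 0 (- 1) 0 0 c22 c23 c33"
  by (rule quad_sum_lin[of "1" "1" "0" "0" "1" "- 1" "0" "0" "0" "0" "1" "0" "0" "0" "0" "1" "1"],
      simp add: add_self, simp, simp only: quad_def k3_simps)

lemma quad_sum_split1:
  fixes a b c c22 c33 :: 'k
  shows "quad_sum w z a 0 0 0 0 1 0 0 0 c33
    = quad_sum w z a 0 0 0 1 0 0 (- 1) 0 c33"
  by (rule quad_sum_lin[of "1" "0" "0" "0" "0" "1" "1" "0" "0" "1" "- 1" "0" "0" "0" "0" "1" "1"],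
      simp add: add_self, simp, simp only: quad_def k3_simps)

lemma quad_sum_split2:
  fixes a b c c22 c33 :: 'k
  shows "quad_sum w z a 0 0 0 b 0 0 0 1 0
    = quad_sum w z a 0 0 0 b 0 0 1 0 (- 1)"
  by (rule quad_sum_lin[of "1" "0" "0" "0" "0" "1" "0" "0" "0" "0" "1" "1" "0" "0" "1" "- 1" "1"],
      simp add: add_self, simp, simp only: quad_def k3_simps)

text \<open>Since \<open>2 = - 1\<close>, the sum of the squares of \<open>x0 + x1\<close> and
  \<open>x0 - x1\<close> is the negative of the sum of the squares of \<open>x0\<close> and
  \<open>x1\<close>. Two equal diagonal entries can thus change sign together.\<close>

lemma quad_sum_pair:
  fixes a b c c22 c33 :: 'k
  shows "quad_sum w z 1 0 0 0 1 0 0 c22 c23 c33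
    = quad_sum w z (- 1) 0 0 0 (- 1) 0 0 c22 c23 c33"
  by (rule quad_sum_lin[of "1" "1" "0" "0" "1" "- 1" "0" "0" "0" "0" "1" "0" "0" "0" "0" "1" "1"],
      simp add: add_self, simp, simp only: quad_def k3_simps)

text \<open>The substitution is the identity with \<open>e = - 1\<close>: a form and its negative
  have the same zeros.\<close>

lemma quad_sum_uminus:
  fixes a b c c22 c33 :: 'k
  shows "quad_sum w z a 0 0 0 b 0 0 c 0 d
    = quad_sum w z (- a) 0 0 0 (- b) 0 0 (- c) 0 (- d)"
  by (rule quad_sum_lin[of "1" "0" "0" "0" "0" "1" "0" "0" "0" "0" "1" "0" "0" "0" "0" "1" "- 1"],
      force simp: add_eq_0_iff, simp, simp only: quad_def k3_simps)

end

section \<open>Sums over all quadratic forms\<close>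

context ternary
begin

lemma sum_k: "(\<Sum>x\<in>(UNIV :: 'k set). F x) = F 0 + F 1 + (F (- 1) :: 'r::comm_ring_1)"
  using neg_one_neq_one by (simp add: UNIV_k add.assoc)

lemma sum_prod_UNIV:
  "(\<Sum>p\<in>UNIV. F p) = (\<Sum>x\<in>UNIV. \<Sum>y\<in>UNIV. F (x, y))"
  by (simp add: sum.cartesian_product)

lemma sum_kspace_10:
  "(\<Sum>f\<in>kspace 10. point_sum w z (quadric_zeros (f :: 'k list)))
    = (\<Sum>((a, b1, b2, b3), (c11, c12, c13, c22, c23, c33))\<in>UNIV. quad_sum w z (a :: 'k) b1 b2 b3 c11 c12 c13 c22 c23 c33)"
  by (rule sum.reindex_bij_witness[of _
      "\<lambda>((a :: 'k, b1 :: 'k, b2 :: 'k, b3 :: 'k), (c11 :: 'k, c12 :: 'k, c13 :: 'k, c22 :: 'k, c23 :: 'k, c33 :: 'k)). [b1, c11, c12, c13, c23, c22, c33, b2, b3, a]"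
      "\<lambda>f :: 'k list. ((f ! 9, f ! 0, f ! 7, f ! 8), (f ! 1, f ! 2, f ! 3, f ! 5, f ! 4, f ! 6))"])
    (auto simp: kspace_numeral quad_sum_def)

definition diag :: "(nat \<Rightarrow> 'r::comm_ring_1) \<Rightarrow> 'r \<Rightarrow> 'k \<Rightarrow> 'k \<Rightarrow> 'k \<Rightarrow> 'k \<Rightarrow> 'r" where
  "diag w z a b c d = quad_sum w z a 0 0 0 b 0 0 c 0 d"

text \<open>If \<open>c22\<close> is a unit, completing the square absorbs the three values of
  \<open>c23\<close>. If \<open>c22 = 0\<close> and \<open>c23\<close> is a unit, all six forms
  split as a hyperbolic plane. The remaining forms are already diagonal.\<close>

lemma sum_binary:
  "(\<Sum>(c22, c23, c33)\<in>UNIV. quad_sum w z (a :: 'k) 0 0 0 b 0 0 c22 c23 c33)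
    = 3 * (\<Sum>d\<in>UNIV. diag w z a b 1 d) + 3 * (\<Sum>d\<in>UNIV. diag w z a b (- 1) d)
      + (\<Sum>d\<in>UNIV. diag w z a b 0 d) + 6 * diag w z a b 1 (- 1)"
proof -
  have pivot: "(\<Sum>c33\<in>UNIV. quad_sum w z a 0 0 0 b 0 0 c c23 c33) = (\<Sum>d\<in>UNIV. diag w z a b c d)"
    if "c * c = 1" for c c23 :: 'k
    by (rule sum.reindex_bij_witness[of _ "\<lambda>d. d + c * c23 * c23" "\<lambda>d. d - c * c23 * c23"])
      (auto simp: diag_def quad_sum_pivot2[OF that, of _ _ _ _ c23])
  have ker_form: "quad_sum w z a 0 0 0 b 0 0 0 c c33 = diag w z a b 1 (- 1)" if "c * c = 1" for c c33 :: 'k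
    using quad_sum_hyp2[OF that, of w z a b c33] by (simp add: quad_sum_split2 diag_def)
  define X where "X c22 c23 = (\<Sum>c33\<in>UNIV. quad_sum w z a 0 0 0 b 0 0 c22 c23 c33)" for c22 c23
  have "(\<Sum>(c22, c23, c33)\<in>UNIV. quad_sum w z a 0 0 0 b 0 0 c22 c23 c33) = (\<Sum>c22\<in>UNIV. \<Sum>c23\<in>UNIV. X c22 c23)"
    by (simp add: sum_prod_UNIV X_def)
  moreover have "X 1 c = (\<Sum>d\<in>UNIV. diag w z a b 1 d)" "X (- 1) c = (\<Sum>d\<in>UNIV. diag w z a b (- 1) d)" for c
    unfolding X_def by (rule pivot, simp)+
  moreover have "X 0 1 = 3 * diag w z a b 1 (- 1)" "X 0 (- 1) = 3 * diag w z a b 1 (- 1)"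
    unfolding X_def by (simp_all add: ker_form card3)
  moreover have "X 0 0 = (\<Sum>d\<in>UNIV. diag w z a b 0 d)"
    by (simp add: X_def diag_def)
  ultimately show ?thesis
    by (simp add: sum_k[of "\<lambda>c. X _ c"] sum_k[of "\<lambda>c. X c _ + X c _ + X c _"])
qed

text \<open>A unit \<open>c11\<close> absorbs the nine pairs \<open>(c12, c13)\<close>. For
  \<open>c11 = 0\<close> each of the eight nonzero pairs splits off a hyperbolic plane, which leaves
  two of the remaining coefficients free; this gives 8 * 9 = 72.\<close>

lemma sum_ternary:
  "(\<Sum>(c11, c12, c13, c22, c23, c33)\<in>UNIV. quad_sum w z (a :: 'k) 0 0 0 c11 c12 c13 c22 c23 c33)
    = 9 * (\<Sum>(c22, c23, c33)\<in>UNIV. quad_sum w z a 0 0 0 1 0 0 c22 c23 c33)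
      + 9 * (\<Sum>(c22, c23, c33)\<in>UNIV. quad_sum w z a 0 0 0 (- 1) 0 0 c22 c23 c33)
      + (\<Sum>(c22, c23, c33)\<in>UNIV. quad_sum w z a 0 0 0 0 0 0 c22 c23 c33)
      + 72 * (\<Sum>d\<in>UNIV. diag w z a 1 (- 1) d)"
proof -
  define X where "X c11 c12 c13 = (\<Sum>(c22, c23, c33)\<in>UNIV. quad_sum w z a 0 0 0 c11 c12 c13 c22 c23 c33)"
    for c11 c12 c13
  have X: "(\<Sum>(c11, c12, c13, c22, c23, c33)\<in>UNIV. quad_sum w z a 0 0 0 c11 c12 c13 c22 c23 c33)
      = (\<Sum>c11\<in>UNIV. \<Sum>c12\<in>UNIV. \<Sum>c13\<in>UNIV. X c11 c12 c13)"
    by (simp add: sum_prod_UNIV X_def)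
  \<comment> \<open>The shift caused by completing the square is a bijection of the remaining
    coefficients.\<close>
  have pivot: "X c c12 c13 = X c 0 0" if "c * c = 1" for c c12 c13
    unfolding X_def
    by (rule sum.reindex_bij_witness[of _
        "\<lambda>(p, q, r). (p + c * c12 * c12, q - c * c12 * c13, r + c * c13 * c13)"
        "\<lambda>(p, q, r). (p - c * c12 * c12, q + c * c12 * c13, r - c * c13 * c13)"])
      (auto simp: quad_sum_pivot1[OF that, of _ _ _ c12 c13])
  have ker_form: "X 0 c c13 = 9 * (\<Sum>d\<in>UNIV. diag w z a 1 (- 1) d)" if "c * c = 1" for c c13
  proof -
    have "X 0 c c13 = (\<Sum>(p :: 'k, q :: 'k, r)\<in>UNIV. diag w z a 1 (- 1) r)"
      unfolding X_def
      by (rule sum.reindex_bij_witness[of _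
          "\<lambda>(p, q, r). (p, q, r - (c13 * c13 * p - c * c13 * q))"
          "\<lambda>(p, q, r). (p, q, r + (c13 * c13 * p - c * c13 * q))"])
        (auto simp: quad_sum_hyp1[OF that, of _ _ _ c13] quad_sum_split1 diag_def)
    then show ?thesis
      by (simp add: sum_prod_UNIV card3)
  qed
  have swap: "X 0 0 c = X 0 c 0" for c
    unfolding X_def
    by (rule sum.reindex_bij_witness[of _ "\<lambda>(p, q, r). (r, q, p)" "\<lambda>(p, q, r). (r, q, p)"])
      (auto simp: quad_sum_swap23[of _ _ _ _ _ _ _ 0 c])
  have *: "X 1 c12 c13 = X 1 0 0" "X (- 1) c12 c13 = X (- 1) 0 0" for c12 c13
    by (rule pivot, simp)+
  define x1 xm h where "x1 = X 1 0 0" and "xm = X (- 1) 0 0"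
    and "h = 9 * (\<Sum>d\<in>UNIV. diag w z a 1 (- 1) d)"
  have "X 1 c12 c13 = x1" "X (- 1) c12 c13 = xm" "X 0 1 c13 = h" "X 0 (- 1) c13 = h"
    "X 0 0 1 = h" "X 0 0 (- 1) = h" for c12 c13
    using ker_form[of 1 c13] ker_form[of "- 1" c13] ker_form[of 1 0] ker_form[of "- 1" 0] * swap by (simp_all add: x1_def xm_def h_def)
  then have "(\<Sum>c11\<in>UNIV. \<Sum>c12\<in>UNIV. \<Sum>c13\<in>UNIV. X c11 c12 c13) = 9 * x1 + 9 * xm + X 0 0 0 + 8 * h"
    by (simp add: sum_k)
  then show ?thesis
    by (simp add: X x1_def xm_def h_def X_def)
qed

text \<open>A unit \<open>a\<close> absorbs the 27 triples \<open>(b1, b2, b3)\<close>. For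
  \<open>a = 0\<close> each of the 26 nonzero triples splits off a hyperbolic plane and leaves three
  coefficients free; this gives 26 * 27 = 702.\<close>

lemma sum_quaternary:
  "(\<Sum>f\<in>kspace 10. point_sum w z (quadric_zeros (f :: 'k list)))
    = 27 * (\<Sum>(c11, c12, c13, c22, c23, c33)\<in>UNIV. quad_sum w z (1 :: 'k) 0 0 0 c11 c12 c13 c22 c23 c33)
      + 27 * (\<Sum>(c11, c12, c13, c22, c23, c33)\<in>UNIV. quad_sum w z (- 1 :: 'k) 0 0 0 c11 c12 c13 c22 c23 c33)
      + (\<Sum>(c11, c12, c13, c22, c23, c33)\<in>UNIV. quad_sum w z (0 :: 'k) 0 0 0 c11 c12 c13 c22 c23 c33)
      + 702 * (\<Sum>(c22, c23, c33)\<in>UNIV. quad_sum w z (1 :: 'k) 0 0 0 (- 1) 0 0 c22 c23 c33)"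
proof -
  define X :: "'k \<Rightarrow> 'k \<Rightarrow> 'k \<Rightarrow> 'k \<Rightarrow> 'a"
    where "X a b1 b2 b3 = (\<Sum>(c11, c12, c13, c22, c23, c33)\<in>UNIV. quad_sum w z a b1 b2 b3 c11 c12 c13 c22 c23 c33)"
    for a b1 b2 b3
  define h where "h = 27 * (\<Sum>(c22, c23, c33)\<in>UNIV. quad_sum w z (1 :: 'k) 0 0 0 (- 1) 0 0 c22 c23 c33)"
  have X: "(\<Sum>f\<in>kspace 10. point_sum w z (quadric_zeros (f :: 'k list)))
      = (\<Sum>a\<in>UNIV. \<Sum>b1\<in>UNIV. \<Sum>b2\<in>UNIV. \<Sum>b3\<in>UNIV. X a b1 b2 b3)"
    by (simp add: sum_kspace_10 sum_prod_UNIV X_def)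
  have pivot: "X a b1 b2 b3 = X a 0 0 0" if "a * a = 1" for a b1 b2 b3
    unfolding X_def
    by (rule sum.reindex_bij_witness[of _
        "\<lambda>(p, q, r, s, t, u). (p + a * b1 * b1, q - a * b1 * b2, r - a * b1 * b3,
            s + a * b2 * b2, t - a * b2 * b3, u + a * b3 * b3)"
        "\<lambda>(p, q, r, s, t, u). (p - a * b1 * b1, q + a * b1 * b2, r + a * b1 * b3,
            s - a * b2 * b2, t + a * b2 * b3, u - a * b3 * b3)"])
      (auto simp: quad_sum_pivot0[OF that, of _ _ b1 b2 b3])
  have ker_form: "X 0 b b2 b3 = h" if "b * b = 1" for b b2 b3
  proof -
    have "X 0 b b2 b3 = (\<Sum>(p :: 'k, q :: 'k, r :: 'k, s, t, u)\<in>UNIV. quad_sum w z (1 :: 'k) 0 0 0 (- 1) 0 0 s t u)"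
      unfolding X_def
      by (rule sum.reindex_bij_witness[of _
          "\<lambda>(p, q, r, s, t, u). (p, q, r, s - (b2 * b2 * p - b * b2 * q),
            t - (- b2 * b3 * p - b * b3 * q - b * b2 * r), u - (b3 * b3 * p - b * b3 * r))"
          "\<lambda>(p, q, r, s, t, u). (p, q, r, s + (b2 * b2 * p - b * b2 * q),
            t + (- b2 * b3 * p - b * b3 * q - b * b2 * r), u + (b3 * b3 * p - b * b3 * r))"])
        (auto simp: quad_sum_hyp0[OF that, of _ _ b2 b3] quad_sum_split0)
    then show ?thesis
      by (simp add: h_def sum_prod_UNIV card3)
  qed
  have swap2: "X 0 0 b2 b3 = X 0 b2 0 b3" for b2 b3
    unfolding X_def
    by (rule sum.reindex_bij_witness[of _
        "\<lambda>(p, q, r, s, t, u). (s, q, t, p, r, u)" "\<lambda>(p, q, r, s, t, u). (s, q, t, p, r, u)"])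
      (auto simp: quad_sum_swap12[of _ _ 0 0 b2 b3])
  have swap3: "X 0 0 0 b3 = X 0 b3 0 0" for b3
    unfolding X_def
    by (rule sum.reindex_bij_witness[of _
        "\<lambda>(p, q, r, s, t, u). (u, t, r, s, q, p)" "\<lambda>(p, q, r, s, t, u). (u, t, r, s, q, p)"])
      (auto simp: quad_sum_swap13[of _ _ 0 0 0 b3])
  define x1 xm where "x1 = X 1 0 0 0" and "xm = X (- 1) 0 0 0"
  have "X 1 b1 b2 b3 = x1" "X (- 1) b1 b2 b3 = xm" "X 0 1 b2 b3 = h" "X 0 (- 1) b2 b3 = h"
    "X 0 0 1 b3 = h" "X 0 0 (- 1) b3 = h" "X 0 0 0 1 = h" "X 0 0 0 (- 1) = h" for b1 b2 b3
    unfolding x1_def xm_def swap3 swap2[of 1] swap2[of "- 1"]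
    by (rule pivot ker_form, simp)+
  then have "(\<Sum>a\<in>UNIV. \<Sum>b1\<in>UNIV. \<Sum>b2\<in>UNIV. \<Sum>b3\<in>UNIV. X a b1 b2 b3)
      = 27 * x1 + 27 * xm + X 0 0 0 0 + 26 * h"
    by (simp add: sum_k)
  then show ?thesis
    by (simp add: X x1_def xm_def h_def X_def)
qed

text \<open>Up to scaling and coordinate changes a diagonal form is determined by its rank and, in
  even rank, by its discriminant. The multiplicities of the six nonzero classes add up to
  \<open>3 ^ 10 - 1\<close>.\<close>

lemma sum_diag:
  "(\<Sum>f\<in>kspace 10. point_sum w z (quadric_zeros (f :: 'k list))) =
     diag w z 0 0 0 0 + 80 * diag w z 1 0 0 0 + 1560 * diag w z 1 (- 1) 0 0 + 780 * diag w z 1 1 0 0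
     + 18720 * diag w z 1 (- 1) 1 0 + 21060 * diag w z 1 (- 1) 1 (- 1) + 16848 * diag w z 1 1 1 (- 1)"
proof -
  let ?D = "diag w z"
  \<comment> \<open>Used as ordered rewrite rules, these adjacent transpositions sort the diagonal
    entries.\<close>
  have sw: "?D a b c d = ?D b a c d" "?D a b c d = ?D a c b d" "?D a b c d = ?D a b d c" for a b c d
    unfolding diag_def by (rule quad_sum_swap01 quad_sum_swap12 quad_sum_swap23)+
  have neg: "?D a b c d = ?D (- a) (- b) (- c) (- d)" for a b c d
    unfolding diag_def by (rule quad_sum_uminus)
  have pair: "?D 1 1 c d = ?D (- 1) (- 1) c d" for c d
    unfolding diag_def by (rule quad_sum_pair)
  have e: "?D (- 1) 0 0 0 = ?D 1 0 0 0" "?D (- 1) (- 1) 0 0 = ?D 1 1 0 0"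
    "?D (- 1) (- 1) (- 1) 0 = ?D 1 1 (- 1) 0"
    "?D 1 1 1 0 = ?D 1 (- 1) (- 1) 0" "?D 1 1 (- 1) 0 = ?D 1 (- 1) (- 1) 0"
    "?D 1 1 1 1 = ?D 1 1 (- 1) (- 1)" "?D (- 1) (- 1) (- 1) (- 1) = ?D 1 1 (- 1) (- 1)"
    "?D 1 (- 1) (- 1) (- 1) = ?D 1 1 1 (- 1)"
    using neg[of 1 0 0 0] neg[of 1 1 "- 1" 0] neg[of 1 "- 1" "- 1" "- 1"] pair[of 0 0] pair[of 1 0]
      pair[of "- 1" 0] pair[of 1 1] pair[of "- 1" "- 1"]
    by (simp_all add: sw)
  show ?thesis
    unfolding sum_quaternary sum_ternary sum_binary sum_k
    using e by (simp add: sw)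
qed
end

section \<open>Counting subcodes\<close>

definition indep_lists :: "nat \<Rightarrow> ('k::field ^ 'n) set \<Rightarrow> ('k ^ 'n) list set" where
  "indep_lists r U = {us. length us = r \<and> set us \<subseteq> U \<and> distinct us \<and> vec.independent (set us)}"

definition zeros :: "('k::field ^ 'n) set \<Rightarrow> 'n set" where
  "zeros D = {j. \<forall>c\<in>D. c $ j = 0}"

text \<open>This expands a product of factors \<open>z = 1 + (z - 1)\<close>, one for each element
  of \<open>S\<close>.\<close>

lemma sum_Pow_power:
  fixes z :: "'r::comm_ring_1"
  assumes "finite S"
  shows "(\<Sum>J\<in>Pow S. (z - 1) ^ card J) = z ^ card S"
  using assms
proof (induction S)
  case (insert x S)
  have "(\<Sum>J\<in>Pow S. (z - 1) ^ card (insert x J)) = (\<Sum>J\<in>Pow S. (z - 1) * (z - 1) ^ card J)"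
  proof (rule sum.cong)
    fix J assume "J \<in> Pow S"
    then have "finite J" "x \<notin> J"
      using insert by (auto intro: finite_subset)
    then show "(z - 1) ^ card (insert x J) = (z - 1) * (z - 1) ^ card J"
      by simp
  qed simp
  also have "\<dots> = (z - 1) * z ^ card S"
    using insert by (simp add: sum_distrib_left[symmetric])
  finally show ?case
    using insert by (simp add: sum_Pow_insert left_diff_distrib)
qed simp

lemma card_code_supp:
  fixes D :: "('k::field ^ 40) set"
  shows "card (code_supp D) = 40 - card (zeros D)"
proof -
  have "code_supp D = UNIV - zeros D"
    by (auto simp: code_supp_def zeros_def)
  then show ?thesis
    by (simp add: card_Diff_subset)
qed

lemma subspace_vanishing_words: "vec.subspace C \<Longrightarrow> vec.subspace {c \<in> C. \<forall>j\<in>J. c $ j = 0}"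
  by (auto simp: vec.subspace_def)

lemma span_rows:
  fixes G :: "'k::field ^ 'n ^ 'm"
  shows "vec.span (rows G) = range (\<lambda>a. \<Sum>i\<in>UNIV. a $ i *s row i G)" (is "_ = ?R")
proof
  have "vec.subspace ?R"
  proof (rule vec.subspaceI)
    show "0 \<in> ?R"
      by (rule range_eqI[of _ _ 0]) simp
    show "x + y \<in> ?R" if xy: "x \<in> ?R" "y \<in> ?R" for x y
    proof -
      obtain a b where "x = (\<Sum>i\<in>UNIV. a $ i *s row i G)" "y = (\<Sum>i\<in>UNIV. b $ i *s row i G)"
        using xy by blast
      then show ?thesis
        by (intro range_eqI[of _ _ "a + b"]) (simp add: sum.distrib vec.scale_left_distrib)
    qed
    show "c *s x \<in> ?R" if x: "x \<in> ?R" for c x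
    proof -
      obtain a where "x = (\<Sum>i\<in>UNIV. a $ i *s row i G)"
        using x by blast
      then show ?thesis
        by (intro range_eqI[of _ _ "c *s a"]) (simp add: vec.scale_sum_right vector_smult_assoc)
    qed
  qed
  moreover have "rows G \<subseteq> ?R"
  proof
    fix x assume "x \<in> rows G"
    then obtain i where "x = row i G"
      by (auto simp: rows_def)
    moreover have "(\<Sum>k\<in>UNIV. axis i 1 $ k *s row k G) = (\<Sum>k\<in>UNIV. if k = i then row i G else 0)"
      by (rule sum.cong) (auto simp: axis_def)
    ultimately show "x \<in> ?R"
      by (intro range_eqI[of _ _ "axis i 1"]) simp
  qed
  ultimately show "vec.span (rows G) \<subseteq> ?R"
    by (rule vec.span_minimal[rotated])
  show "?R \<subseteq> vec.span (rows G)"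
  proof (intro image_subsetI vec.span_sum vec.span_scale vec.span_base)
    show "row i G \<in> rows G" for i
      by (auto simp: rows_def)
  qed
qed

context ternary
begin

lemma finite_vec_k [simp]: "finite (S :: ('k ^ 'n) set)"
proof -
  have "finite (UNIV \<rightarrow>\<^sub>E UNIV :: ('n \<Rightarrow> 'k) set)"
    by (intro finite_PiE) auto
  then have "finite (UNIV :: ('n \<Rightarrow> 'k) set)"
    by (simp add: PiE_def extensional_def Pi_def)
  moreover have "inj (vec_nth :: 'k ^ 'n \<Rightarrow> 'n \<Rightarrow> 'k)"
    by (simp add: inj_def vec_nth_inject)
  ultimately have "finite (UNIV :: ('k ^ 'n) set)"
    by (metis finite_imageD finite_subset subset_UNIV)
  then show ?thesis
    by (rule finite_subset[OF subset_UNIV])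
qed

lemma finite_vec_sets: "finite (A :: ('k ^ 'n) set set)"
proof -
  have "finite (Pow (UNIV :: ('k ^ 'n) set))"
    by (simp only: finite_Pow_iff finite_vec_k)
  then show ?thesis
    by (rule finite_subset[rotated]) auto
qed

text \<open>Every element of the span of \<open>insert b B\<close> is uniquely
  \<open>c *s b + v\<close> with \<open>v\<close> in the span of \<open>B\<close>, so each basis
  vector triples the cardinality.\<close>

lemma card_span_independent:
  fixes B :: "('k ^ 'n) set"
  assumes "vec.independent B"
  shows "card (vec.span B) = 3 ^ card B"
proof -
  have "finite B"
    by simp
  then show ?thesis
    using assms
  proof (induction B)
    case (insert b B)
    have b: "b \<notin> vec.span B" "vec.independent B"
      using insert by (auto simp: vec.independent_insert)
    have "vec.span (insert b B) = (\<lambda>(c, v). c *s b + v) ` (UNIV \<times> vec.span B)"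
    proof (intro equalityI subsetI)
      fix x assume "x \<in> vec.span (insert b B)"
      then obtain c where "x - c *s b \<in> vec.span B"
        by (auto simp: vec.span_insert)
      moreover have "x = c *s b + (x - c *s b)"
        by simp
      ultimately show "x \<in> (\<lambda>(c, v). c *s b + v) ` (UNIV \<times> vec.span B)"
        by force
    next
      fix x assume "x \<in> (\<lambda>(c, v). c *s b + v) ` (UNIV \<times> vec.span B)"
      then obtain c v where "x = c *s b + v" "v \<in> vec.span B"
        by auto
      moreover have "vec.span B \<subseteq> vec.span (insert b B)"
        by (rule vec.span_mono) auto
      moreover have "c *s b \<in> vec.span (insert b B)"
        by (intro vec.span_scale vec.span_base) simp
      ultimately show "x \<in> vec.span (insert b B)"
        by (auto intro: vec.span_add)
    qed
    moreover have "inj_on (\<lambda>(c, v). c *s b + v) (UNIV \<times> vec.span B)"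
    proof (rule inj_onI, clarify)
      fix c d v u assume vu: "v \<in> vec.span B" "u \<in> vec.span B" and eq: "c *s b + v = d *s b + u"
      have "(c - d) *s b = u - v"
        using eq by (simp add: algebra_simps vec.scale_left_diff_distrib)
      then have "(c - d) *s b \<in> vec.span B"
        using vu by (simp add: vec.span_diff)
      then have "inverse (c - d) *s ((c - d) *s b) \<in> vec.span B"
        by (rule vec.span_scale)
      moreover have "inverse (c - d) *s ((c - d) *s b) = b" if "c \<noteq> d"
        using that by (simp only: vec.scale_scale) simp
      ultimately have "c = d"
        using b by (cases "c = d") auto
      then show "c = d \<and> v = u"
        using eq by simp
    qed
    ultimately show ?case
      using insert b by (simp add: card_image card_cartesian_product card3)
  qed simp
qed

lemma card_subspace:
  fixes U :: "('k ^ 'n) set"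
  assumes "vec.subspace U"
  shows "card U = 3 ^ vec.dim U"
proof -
  obtain B where B: "B \<subseteq> U" "vec.independent B" "U \<subseteq> vec.span B" "card B = vec.dim U"
    using vec.basis_exists by blast
  then have "vec.span B = U"
    using assms by (metis subset_antisym vec.span_minimal)
  then show ?thesis
    using card_span_independent[OF B(2)] B(4) by simp
qed

text \<open>A new vector has to avoid the span of the earlier ones, which has \<open>3 ^ r\<close>
  elements. The integer formula also covers lists longer than the dimension, where one factor is
  zero.\<close>

lemma card_indep_lists:
  fixes U :: "('k ^ 'n) set"
  assumes "vec.subspace U"
  shows "int (card (indep_lists r U)) = (\<Prod>i<r. int (card U) - 3 ^ i)"
proof (induction r)
  case 0
  have "indep_lists 0 U = {[]}"
    by (auto simp: indep_lists_def vec.independent_empty)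
  then show ?case
    by simp
next
  case (Suc r)
  have fin: "finite (indep_lists r U)"
    by (rule finite_subset[OF _ finite_lists_length_eq[of UNIV r]]) (auto simp: indep_lists_def)
  have eq: "indep_lists (Suc r) U = (\<lambda>(us, u). u # us) ` (SIGMA us : indep_lists r U. U - vec.span (set us))"
  proof (intro equalityI subsetI)
    fix vs assume vs: "vs \<in> indep_lists (Suc r) U"
    then obtain u us where "vs = u # us"
      by (cases vs) (auto simp: indep_lists_def)
    with vs show "vs \<in> (\<lambda>(us, u). u # us) ` (SIGMA us : indep_lists r U. U - vec.span (set us))"
      by (auto simp: indep_lists_def vec.independent_insert image_iff)
  next
    fix vs assume "vs \<in> (\<lambda>(us, u). u # us) ` (SIGMA us : indep_lists r U. U - vec.span (set us))"
    then obtain u us where "vs = u # us" "us \<in> indep_lists r U" "u \<in> U" "u \<notin> vec.span (set us)"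
      by auto
    then show "vs \<in> indep_lists (Suc r) U"
      using vec.independent_insertI[of u "set us"] by (auto simp: indep_lists_def vec.span_base)
  qed
  have card: "card (U - vec.span (set us)) = card U - 3 ^ r" "3 ^ r \<le> card U" if "us \<in> indep_lists r U" for us
  proof -
    have "card (vec.span (set us)) = 3 ^ r"
      using that card_span_independent[of "set us"] by (auto simp: indep_lists_def distinct_card)
    moreover have "vec.span (set us) \<subseteq> U"
      using that assms by (intro vec.span_minimal) (auto simp: indep_lists_def)
    ultimately show "card (U - vec.span (set us)) = card U - 3 ^ r" "3 ^ r \<le> card U"
      using card_mono[of U "vec.span (set us)"] by (simp_all add: card_Diff_subset)
  qed
  have "card (indep_lists (Suc r) U) = card (SIGMA us : indep_lists r U. U - vec.span (set us))"
    unfolding eq by (rule card_image) (auto simp: inj_on_def)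
  also have "\<dots> = (\<Sum>us\<in>indep_lists r U. card (U - vec.span (set us)))"
    using fin by (intro card_SigmaI) auto
  finally have "int (card (indep_lists (Suc r) U)) = (\<Sum>us\<in>indep_lists r U. int (card (U - vec.span (set us))))"
    by simp
  also have "\<dots> = (\<Sum>us\<in>indep_lists r U. int (card U) - 3 ^ r)"
    by (rule sum.cong) (simp_all add: card of_nat_diff)
  finally have "int (card (indep_lists (Suc r) U)) = (\<Sum>us\<in>indep_lists r U. int (card U) - 3 ^ r)" .
  then show ?case
    using Suc by simp
qed

text \<open>The independent lists in \<open>U\<close> are partitioned by their spans, and all blocks
  have the same size.\<close>

lemma card_subcodes:
  fixes U :: "('k ^ 'n) set"
  assumes "vec.subspace U"
  shows "int (card (subcodes r U)) * (\<Prod>i<r. 3 ^ r - 3 ^ i) = (\<Prod>i<r. int (card U) - 3 ^ i)"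
proof -
  have span: "vec.span (set us) = D" if "us \<in> indep_lists r D" "D \<in> subcodes r U" for us D
  proof -
    have "card (set us) = vec.dim D" "set us \<subseteq> D" "vec.independent (set us)" "vec.subspace D"
      using that by (auto simp: indep_lists_def subcodes_def distinct_card)
    then show ?thesis
      using vec.card_eq_dim[of "set us" D] vec.span_minimal[of "set us" D] by auto
  qed
  have union: "indep_lists r U = (\<Union>D\<in>subcodes r U. indep_lists r D)"
  proof (intro equalityI subsetI)
    fix us assume us: "us \<in> indep_lists r U"
    have "vec.span (set us) \<in> subcodes r U"
      using us assms vec.span_minimal[of "set us" U] vec.dim_eq_card_independent[of "set us"]
      by (auto simp: indep_lists_def subcodes_def distinct_card)
    moreover have "us \<in> indep_lists r (vec.span (set us))"
      using us by (auto simp: indep_lists_def vec.span_base)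
    ultimately show "us \<in> (\<Union>D\<in>subcodes r U. indep_lists r D)"
      by blast
  qed (auto simp: indep_lists_def subcodes_def)
  have fin: "finite (indep_lists r D)" for D :: "('k ^ 'n) set"
    by (rule finite_subset[OF _ finite_lists_length_eq[of UNIV r]]) (auto simp: indep_lists_def)
  have finsub: "finite (subcodes r U)"
    by (rule finite_vec_sets)
  have "card (indep_lists r U) = (\<Sum>D\<in>subcodes r U. card (indep_lists r D))"
    unfolding union
  proof (rule card_UN_disjoint)
    show "\<forall>D\<in>subcodes r U. \<forall>E\<in>subcodes r U. D \<noteq> E \<longrightarrow> indep_lists r D \<inter> indep_lists r E = {}"
      using span by blast
  qed (use fin finsub in auto)
  then have "(\<Prod>i<r. int (card U) - 3 ^ i) = (\<Sum>D\<in>subcodes r U. int (card (indep_lists r D)))"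
    using card_indep_lists[OF assms, of r] by simp
  also have "\<dots> = (\<Sum>D\<in>subcodes r U. (\<Prod>i<r. 3 ^ r - 3 ^ i))"
  proof (rule sum.cong)
    fix D assume "D \<in> subcodes r U"
    then have "vec.subspace D" "card D = 3 ^ r"
      by (auto simp: subcodes_def card_subspace)
    then show "int (card (indep_lists r D)) = (\<Prod>i<r. 3 ^ r - 3 ^ i)"
      by (simp add: card_indep_lists)
  qed simp
  finally show ?thesis
    by simp
qed

text \<open>The power of \<open>z\<close> is expanded over subsets \<open>J\<close> of the common
  zeros and the sums are exchanged. Subcodes that vanish on \<open>J\<close> are the subspaces of
  the space of words that vanish on \<open>J\<close>, and \<open>card_subcodes\<close> counts
  them.\<close>

lemma subcode_enumerator:
  fixes C :: "('k ^ 'n) set" and z :: "'r::comm_ring_1"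
  assumes "vec.subspace C"
  shows "of_int (\<Prod>i<r. 3 ^ r - 3 ^ i) * (\<Sum>D\<in>subcodes r C. z ^ card (zeros D))
    = (\<Sum>J\<in>UNIV. (z - 1) ^ card J * of_int (\<Prod>i<r. int (card {c \<in> C. \<forall>j\<in>J. c $ j = 0}) - 3 ^ i))"
proof -
  have fin: "finite (subcodes r C)"
    by (rule finite_vec_sets)
  have "(\<Sum>D\<in>subcodes r C. z ^ card (zeros D)) = (\<Sum>D\<in>subcodes r C. \<Sum>J\<in>Pow (zeros D). (z - 1) ^ card J)"
    by (simp add: sum_Pow_power)
  also have "\<dots> = (\<Sum>D\<in>subcodes r C. \<Sum>J | J \<in> UNIV \<and> J \<subseteq> zeros D. (z - 1) ^ card J)"
    by (simp add: Pow_def)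
  also have "\<dots> = (\<Sum>J\<in>UNIV. \<Sum>D | D \<in> subcodes r C \<and> J \<subseteq> zeros D. (z - 1) ^ card J)"
    using fin by (intro sum.swap_restrict) auto
  also have "\<dots> = (\<Sum>J\<in>UNIV. (z - 1) ^ card J * of_int (int (card (subcodes r {c \<in> C. \<forall>j\<in>J. c $ j = 0}))))"
  proof (rule sum.cong)
    fix J :: "'n set"
    have "{D. D \<in> subcodes r C \<and> J \<subseteq> zeros D} = subcodes r {c \<in> C. \<forall>j\<in>J. c $ j = 0}"
      by (auto simp: subcodes_def zeros_def)
    then show "(\<Sum>D | D \<in> subcodes r C \<and> J \<subseteq> zeros D. (z - 1) ^ card J)
        = (z - 1) ^ card J * of_int (int (card (subcodes r {c \<in> C. \<forall>j\<in>J. c $ j = 0})))"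
      by (simp add: mult.commute)
  qed simp
  finally have "of_int (\<Prod>i<r. 3 ^ r - 3 ^ i) * (\<Sum>D\<in>subcodes r C. z ^ card (zeros D))
    = (\<Sum>J\<in>UNIV. (z - 1) ^ card J * of_int (int (card (subcodes r {c \<in> C. \<forall>j\<in>J. c $ j = 0})) * (\<Prod>i<r. 3 ^ r - 3 ^ i)))"
    by (simp only: sum_distrib_left of_int_mult ac_simps)
  then show ?thesis
    unfolding card_subcodes[OF subspace_vanishing_words[OF assms]] .
qed

text \<open>The factor \<open>W(J) - 1\<close> counts the nonzero forms \<open>f\<close> that vanish
  on \<open>J\<close>. After exchanging the sums, \<open>J\<close> ranges over the subsets of the
  zero set of \<open>f\<close>.\<close>

lemma sum_vanishing_split:
  fixes z :: "'r::comm_ring_1"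
  shows "(\<Sum>J\<in>Pow kpoints. (z - 1) ^ card J * (of_int (int (card (vanishing J :: 'k list set)) - 1) * w (card (vanishing J))))
    = (\<Sum>f\<in>kspace 10 - {replicate 10 0}. point_sum w z (quadric_zeros (f :: 'k list)))"
proof -
  let ?N = "kspace 10 - {replicate 10 (0 :: 'k)}"
  have zero: "qform (replicate 10 0) x = (0 :: 'k)" for x
    by (cases x) (simp add: qform_def eval_nat_numeral)
  have quadric_zeros: "Pow (quadric_zeros f) = {J \<in> Pow kpoints. J \<subseteq> quadric_zeros f}" for f :: "'k list"
    by (auto simp: quadric_zeros_def)
  have "(\<Sum>f\<in>?N. point_sum w z (quadric_zeros f))
      = (\<Sum>f\<in>?N. \<Sum>J | J \<in> Pow kpoints \<and> J \<subseteq> quadric_zeros f. (z - 1) ^ card J * w (card (vanishing J)))"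
    unfolding point_sum_def quadric_zeros ..
  also have "\<dots> = (\<Sum>J\<in>Pow kpoints. \<Sum>f | f \<in> ?N \<and> J \<subseteq> quadric_zeros f. (z - 1) ^ card J * w (card (vanishing J)))"
    by (intro sum.swap_restrict) auto
  also have "\<dots> = (\<Sum>J\<in>Pow kpoints. (z - 1) ^ card J *
      (of_int (int (card (vanishing J :: 'k list set)) - 1) * w (card (vanishing J))))"
  proof (rule sum.cong)
    fix J :: "('k \<times> 'k \<times> 'k \<times> 'k) set" assume "J \<in> Pow kpoints"
    then have "{f. f \<in> ?N \<and> J \<subseteq> quadric_zeros f} = vanishing J - {replicate 10 0}"
      by (auto simp: vanishing_def quadric_zeros_def)
    moreover have "card (vanishing J :: 'k list set) = Suc (card (vanishing J - {replicate 10 (0 :: 'k)}))"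
      by (rule card.remove) (simp add: vanishing_def, simp add: vanishing_def kspace_def zero)
    ultimately have "int (card {f. f \<in> ?N \<and> J \<subseteq> quadric_zeros f}) = int (card (vanishing J :: 'k list set)) - 1"
      by simp
    note this[symmetric]
    then have "(of_nat (card {f. f \<in> ?N \<and> J \<subseteq> quadric_zeros f}) :: 'r)
        = of_int (int (card (vanishing J :: 'k list set)) - 1)"
      by (simp only: of_int_of_nat_eq)
    then show "(\<Sum>f | f \<in> ?N \<and> J \<subseteq> quadric_zeros f. (z - 1) ^ card J * w (card (vanishing J)))
      = (z - 1) ^ card J * (of_int (int (card (vanishing J :: 'k list set)) - 1) * w (card (vanishing J)))"
      by (simp only: sum_constant mult.left_commute)
  qed simp
  finally show ?thesis ..
qed

end

section \<open>The Veronese code\<close>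

definition tup :: "'k ^ 4 \<Rightarrow> 'k \<times> 'k \<times> 'k \<times> 'k" where
  "tup v = (v $ 0, v $ 1, v $ 2, v $ 3)"

lemma tup_inject: "tup u = tup v \<longleftrightarrow> u = v"
proof
  assume "tup u = tup v"
  then have "u $ 0 = v $ 0" "u $ 1 = v $ 1" "u $ 2 = v $ 2" "u $ 3 = v $ 3"
    by (auto simp: tup_def)
  \<comment> \<open>\<open>forall_4\<close> uses the indices 1 to 4, and in the type
    \<open>4\<close> the numerals 4 and 0 denote the same index.\<close>
  moreover from this(1) have "u $ 4 = v $ 4"
    using arg_cong[of "4::4" 0 "($) u"] arg_cong[of "4::4" 0 "($) v"] by simp
  ultimately show "u = v"
    using forall_4[of "\<lambda>i. u $ i = v $ i"] by (simp add: vec_eq_iff)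
qed simp

text \<open>Permutes coefficients from the monomial order of \<open>kver\<close> to that of
  \<open>veronese\<close>.\<close>

definition coeff_vec :: "'k::zero list \<Rightarrow> 'k ^ 10" where
  "coeff_vec a = vector [a ! 9, a ! 0, a ! 1, a ! 7, a ! 2, a ! 5, a ! 8, a ! 3, a ! 4, a ! 6]"

lemma coeff_vec_nth:
  "coeff_vec a $ 1 = a ! 9" "coeff_vec a $ 2 = a ! 0" "coeff_vec a $ 3 = a ! 1"
  "coeff_vec a $ 4 = a ! 7" "coeff_vec a $ 5 = a ! 2" "coeff_vec a $ 6 = a ! 5"
  "coeff_vec a $ 7 = a ! 8" "coeff_vec a $ 8 = a ! 3" "coeff_vec a $ 9 = a ! 4"
  "coeff_vec a $ 10 = a ! 6"
  by (simp_all add: coeff_vec_def vector_def)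

lemma sum_coeff_vec_veronese:
  assumes "a \<in> kspace 10"
  shows "(\<Sum>i\<in>UNIV. coeff_vec a $ i * veronese v $ i) = qform a (tup v)"
proof -
  obtain a0 a1 a2 a3 a4 a5 a6 a7 a8 a9 where a: "a = [a0, a1, a2, a3, a4, a5, a6, a7, a8, a9]"
    using assms unfolding kspace_numeral by blast
  have "(\<Sum>i\<in>UNIV. coeff_vec a $ i * veronese v $ i)
      = (\<Sum>i\<in>{1, 2, 3, 4, 5, 6, 7, 8, 9, 10}. coeff_vec a $ i * veronese v $ i)"
    by (simp only: UNIV_10)
  also have "\<dots> = a9 * (v $ 0 * v $ 0) + (a0 * (v $ 0 * v $ 1) + (a1 * (v $ 1 * v $ 1)
     + (a7 * (v $ 0 * v $ 2) + (a2 * (v $ 1 * v $ 2) + (a5 * (v $ 2 * v $ 2)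
     + (a8 * (v $ 0 * v $ 3) + (a3 * (v $ 1 * v $ 3) + (a4 * (v $ 2 * v $ 3) + a6 * (v $ 3 * v $ 3)))))))))"
    by (simp add: coeff_vec_nth veronese_nth a)
  also have "\<dots> = qform a (tup v)"
    by (simp only: a qform_def tup_def kver.simps dot.simps add_0_left add_0_right ac_simps)
  finally show ?thesis .
qed

lemma range_coeff_vec:
  fixes v :: "'k::field ^ 10"
  shows "\<exists>a\<in>kspace 10. v = coeff_vec a"
  by (rule bexI[of _ "[v $ 2, v $ 3, v $ 5, v $ 8, v $ 9, v $ 6, v $ 10, v $ 4, v $ 7, v $ 1]"])
    (simp_all only: vec_eq_iff forall_10 coeff_vec_nth, simp_all add: kspace_def)

context ternary
begin

lemma normalized_representative:
  fixes Q :: "('k ^ 4) set"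
  assumes "Q \<in> proj_points"
  shows "\<exists>v. represents v Q \<and> tup v \<in> kpoints"
proof -
  have Q: "vec.subspace Q" "vec.dim Q = 1"
    using assms by (auto simp: proj_points_def)
  obtain B where B: "B \<subseteq> Q" "vec.independent B" "Q \<subseteq> vec.span B" "card B = vec.dim Q"
    using vec.basis_exists by blast
  then obtain v where v: "B = {v}"
    using Q by (auto simp: card_1_singleton_iff)
  have "Q = vec.span {v}"
    using B Q v by (metis subset_antisym vec.span_minimal)
  moreover have "v \<noteq> 0"
    using B v vec.dependent_zero[of B] by auto
  ultimately have repr: "represents v Q"
    by (simp add: represents_def)
  have "tup v \<noteq> 0"
    using \<open>v \<noteq> 0\<close> tup_inject[of v 0] by (simp add: tup_def zero_prod_def)
  show ?thesis
  proof (cases "tup v \<in> kpoints")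
    case False
    have "tup (- v) = - tup v"
      by (simp add: tup_def)
    then have "tup (- v) \<in> kpoints"
      using False kpoints_uminus[OF \<open>tup v \<noteq> 0\<close>] by simp
    moreover have "represents (- v) Q"
    proof -
      have "vec.span {- v} = vec.span {v}"
      proof (rule vec.span_eq[THEN iffD2], intro conjI)
        show "{- v} \<subseteq> vec.span {v}"
          using vec.span_neg[OF vec.span_base[of v "{v}"]] by simp
        show "{v} \<subseteq> vec.span {- v}"
          using vec.span_neg[OF vec.span_base[of "- v" "{- v}"]] by simp
      qed
      then show ?thesis
        using repr by (simp add: represents_def)
    qed
    ultimately show ?thesis
      by blast
  qed (use repr in blast)
qed

text \<open>Column \<open>j\<close> is a unit \<open>s j\<close> times the image of a normalized
  point, so the codeword of the form \<open>a\<close> has the entries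
  \<open>s j * qform a (x j)\<close>. The units do not affect where it vanishes, and different forms
  give different words by \<open>qform_inj\<close>.\<close>

lemma code_parametrization:
  fixes P :: "40 \<Rightarrow> ('k ^ 4) set" and G :: "'k ^ 40 ^ 10"
  assumes P: "bij_betw P UNIV proj_points" and G: "is_veronese_matrix P G"
  obtains x ev where "bij_betw x UNIV (kpoints :: ('k \<times> 'k \<times> 'k \<times> 'k) set)"
    and "bij_betw ev (kspace 10) (generated_code G)"
    and "\<And>a j. a \<in> kspace 10 \<Longrightarrow> ev a $ j = 0 \<longleftrightarrow> qform a (x j) = 0"
proof -
  have "\<exists>v s. represents v (P j) \<and> tup v \<in> kpoints \<and> s \<noteq> 0 \<and> column j G = s *s veronese v" for j
  proof -
    have "P j \<in> proj_points"
      using P by (auto simp: bij_betw_def)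
    then obtain v where v: "represents v (P j)" "tup v \<in> kpoints"
      using normalized_representative by blast
    have "represents (veronese v) (veronese_point (P j))" "represents (column j G) (veronese_point (P j))"
      using v G by (auto simp: represents_veronese_point is_veronese_matrix_def)
    then have "column j G \<noteq> 0" "vec.span {column j G} = vec.span {veronese v}"
      by (auto simp: represents_def)
    then have "column j G \<in> range (\<lambda>s. s *s veronese v)"
      using vec.span_base[of "column j G" "{column j G}"] by (simp add: vec.span_singleton)
    then obtain s where "column j G = s *s veronese v"
      by blast
    then show ?thesis
      using v \<open>column j G \<noteq> 0\<close> by (metis vec.scale_zero_left)
  qed
  then obtain V s where V: "\<And>j. represents (V j) (P j)" "\<And>j. tup (V j) \<in> kpoints"
    and s: "\<And>j. s j \<noteq> 0" "\<And>j. column j G = s j *s veronese (V j)"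
    by metis
  define x where "x j = tup (V j)" for j
  have "inj x"
  proof (rule injI)
    fix i j assume "x i = x j"
    then have "P i = P j"
      using V(1)[of i] V(1)[of j] by (simp add: x_def tup_inject represents_def)
    then show "i = j"
      using P by (auto simp: bij_betw_def dest: injD)
  qed
  moreover have "range x = kpoints"
  proof (rule card_subset_eq)
    show "card (range x) = card (kpoints :: ('k \<times> 'k \<times> 'k \<times> 'k) set)"
      using \<open>inj x\<close> by (simp add: card_image card_kpoints)
  qed (auto simp: x_def V)
  ultimately have x: "bij_betw x UNIV kpoints"
    by (simp add: bij_betw_def)
  define ev where "ev a = (\<Sum>i\<in>UNIV. coeff_vec a $ i *s row i G)" for a
  have ev: "ev a $ j = s j * qform a (x j)" if "a \<in> kspace 10" for a j
  proof -
    have "ev a $ j = (\<Sum>i\<in>UNIV. coeff_vec a $ i * column j G $ i)"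
      by (simp add: ev_def row_def column_def)
    also have "\<dots> = (\<Sum>i\<in>UNIV. s j * (coeff_vec a $ i * veronese (V j) $ i))"
      by (simp add: s(2) ac_simps)
    also have "\<dots> = s j * qform a (x j)"
      unfolding x_def sum_distrib_left[symmetric] sum_coeff_vec_veronese[OF that] ..
    finally show ?thesis .
  qed
  have "inj_on ev (kspace 10)"
  proof (rule inj_onI)
    fix a b assume ab: "a \<in> kspace 10" "b \<in> kspace 10" "ev a = ev b"
    show "a = b"
    proof (rule qform_inj[OF ab(1,2)])
      fix y :: "'k \<times> 'k \<times> 'k \<times> 'k" assume "y \<in> kpoints"
      then obtain j where "y = x j"
        using x by (auto simp: bij_betw_def)
      moreover have "s j * qform a (x j) = s j * qform b (x j)"
        using ab by (simp add: ev[symmetric])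
      ultimately show "qform a y = qform b y"
        using s(1)[of j] by simp
    qed
  qed
  moreover have "ev ` kspace 10 = generated_code G"
  proof -
    have "range (\<lambda>v. \<Sum>i\<in>UNIV. v $ i *s row i G) = ev ` kspace 10"
    proof (intro equalityI subsetI)
      fix c assume "c \<in> range (\<lambda>v. \<Sum>i\<in>UNIV. v $ i *s row i G)"
      then obtain v where "c = (\<Sum>i\<in>UNIV. v $ i *s row i G)"
        by blast
      moreover obtain a where "a \<in> kspace 10" "v = coeff_vec a"
        using range_coeff_vec by blast
      ultimately show "c \<in> ev ` kspace 10"
        by (auto simp: ev_def)
    qed (auto simp: ev_def)
    then show ?thesis
      by (simp add: generated_code_def span_rows)
  qed
  ultimately have "bij_betw ev (kspace 10) (generated_code G)"
    by (simp add: bij_betw_def)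
  then show ?thesis
    using that[OF x] ev s(1) by simp
qed

lemma card_kspace: "card (kspace n :: 'k list set) = 3 ^ n"
  using card_lists_length_eq[of "UNIV :: 'k set" n] by (simp add: kspace_def card3)

lemma subspace_generated_code: "vec.subspace (generated_code G)"
  by (simp add: generated_code_def)

text \<open>The parametrization shows that the code has \<open>3 ^ 10\<close> words.\<close>

lemma dim_veronese_code:
  fixes P :: "40 \<Rightarrow> ('k ^ 4) set" and G :: "'k ^ 40 ^ 10"
  assumes "bij_betw P UNIV proj_points" "is_veronese_matrix P G"
  shows "vec.dim (generated_code G) = 10"
proof -
  obtain ev where "bij_betw ev (kspace 10 :: 'k list set) (generated_code G)"
    using code_parametrization[OF assms] by metis
  then have "3 ^ vec.dim (generated_code G) = (3 :: nat) ^ 10"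
    using card_subspace[OF subspace_generated_code, of G] bij_betw_same_card card_kspace by metis
  then show ?thesis
    by (rule power_inject_exp[THEN iffD1, rotated]) simp
qed

text \<open>The dimension is written \<open>Suc r\<close> so that the factor for
  \<open>i = 0\<close> can be split off and traded for a sum over forms.\<close>

lemma veronese_subcode_enumerator:
  fixes P :: "40 \<Rightarrow> ('k ^ 4) set" and G :: "'k ^ 40 ^ 10" and z :: "'r::comm_ring_1"
  assumes "bij_betw P UNIV proj_points" "is_veronese_matrix P G"
  shows "of_int (\<Prod>i<Suc r. 3 ^ Suc r - 3 ^ i) * (\<Sum>D\<in>subcodes (Suc r) (generated_code G). z ^ card (zeros D))
    = (\<Sum>f\<in>kspace 10 - {replicate 10 0}. point_sum (\<lambda>c. of_int (\<Prod>i<r. int c - 3 ^ Suc i)) z (quadric_zeros (f :: 'k list)))"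
proof -
  let ?C = "generated_code G"
  obtain x ev where x: "bij_betw x UNIV (kpoints :: ('k \<times> 'k \<times> 'k \<times> 'k) set)"
    and ev: "bij_betw ev (kspace 10) ?C"
    and ev_0: "\<And>a j. a \<in> kspace 10 \<Longrightarrow> ev a $ j = 0 \<longleftrightarrow> qform a (x j) = 0"
    using code_parametrization[OF assms] by blast
  have card: "card {c \<in> ?C. \<forall>j\<in>J. c $ j = 0} = card (vanishing (x ` J))" for J
  proof -
    have C: "?C = ev ` kspace 10"
      using ev by (simp add: bij_betw_def)
    have "{c \<in> ?C. \<forall>j\<in>J. c $ j = 0} = ev ` vanishing (x ` J)"
    proof (intro equalityI subsetI)
      fix c assume "c \<in> {c \<in> ?C. \<forall>j\<in>J. c $ j = 0}"
      then obtain a where "a \<in> kspace 10" "c = ev a" "\<forall>j\<in>J. ev a $ j = 0"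
        unfolding C by blast
      then show "c \<in> ev ` vanishing (x ` J)"
        by (simp add: vanishing_def ev_0)
    next
      fix c assume "c \<in> ev ` vanishing (x ` J)"
      then show "c \<in> {c \<in> ?C. \<forall>j\<in>J. c $ j = 0}"
        unfolding C by (auto simp: vanishing_def ev_0)
    qed
    moreover have "inj_on ev (vanishing (x ` J))"
      by (rule inj_on_subset[of ev "kspace 10"]) (use ev in \<open>auto simp: bij_betw_def vanishing_def\<close>)
    ultimately show ?thesis
      by (simp add: card_image)
  qed
  have inj: "inj x"
    using x by (simp add: bij_betw_def)
  have "of_int (\<Prod>i<Suc r. 3 ^ Suc r - 3 ^ i) * (\<Sum>D\<in>subcodes (Suc r) ?C. z ^ card (zeros D))
      = (\<Sum>J\<in>UNIV. (z - 1) ^ card (x ` J) * of_int (\<Prod>i<Suc r. int (card (vanishing (x ` J))) - 3 ^ i))"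
    unfolding subcode_enumerator[OF subspace_generated_code] card
    by (simp only: card_image[OF inj_on_subset[OF inj subset_UNIV]])
  also have "\<dots> = (\<Sum>J\<in>image x ` UNIV. (z - 1) ^ card J * of_int (\<Prod>i<Suc r. int (card (vanishing J)) - 3 ^ i))"
    using inj by (subst sum.reindex) (auto simp: inj_on_def inj_image_eq_iff)
  also have "image x ` UNIV = Pow kpoints"
    using x image_Pow_surj[of x UNIV kpoints] by (simp add: bij_betw_def)
  also have "(\<Sum>J\<in>Pow kpoints. (z - 1) ^ card J * of_int (\<Prod>i<Suc r. int (card (vanishing J :: 'k list set)) - 3 ^ i))
    = (\<Sum>J\<in>Pow kpoints. (z - 1) ^ card J * (of_int (int (card (vanishing J :: 'k list set)) - 1)
        * of_int (\<Prod>i<r. int (card (vanishing J :: 'k list set)) - 3 ^ Suc i)))"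
    by (simp only: prod.lessThan_Suc_shift power_0 of_int_mult)
  also have "\<dots> = (\<Sum>f\<in>kspace 10 - {replicate 10 0}. point_sum (\<lambda>c. of_int (\<Prod>i<r. int c - 3 ^ Suc i)) z (quadric_zeros (f :: 'k list)))"
    by (rule sum_vanishing_split)
  finally show ?thesis .
qed

end

section \<open>Evaluation\<close>

fun rscale :: "int \<Rightarrow> int list \<Rightarrow> int list" where
  "rscale c [] = []" | "rscale c (a # r) = (c * a) # rscale c r"

fun bscale :: "int \<Rightarrow> bipoly \<Rightarrow> bipoly" where
  "bscale c [] = []" | "bscale c (r # p) = rscale c r # bscale c p"

fun lincomb :: "int list \<Rightarrow> bipoly \<Rightarrow> int list" where
  "lincomb (c # cs) (r # p) = radd (rscale c r) (lincomb cs p)" | "lincomb _ _ = []"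

lemma eval_row_rscale: "eval_row z (rscale c r) = of_int c * eval_row z r"
  by (induction c r rule: rscale.induct) (auto simp: algebra_simps)

lemma eval_bipoly_bscale: "eval_bipoly z (bscale c p) F w = of_int c * eval_bipoly z p F w"
  by (induction c p arbitrary: w rule: bscale.induct) (auto simp: algebra_simps eval_row_rscale)

lemma eval_bipoly_lincomb:
  "eval_bipoly z p (\<lambda>w. w 1) (\<lambda>c. of_int (v c)) = eval_row z (lincomb (map (\<lambda>k. v (3 ^ k)) [0..<length p]) p)"
proof (induction p arbitrary: v)
  case (Cons r p)
  have "map (\<lambda>k. v (3 ^ k)) [0..<length (r # p)] = v 1 # map (\<lambda>k. v (3 * 3 ^ k)) [0..<length p]"
    by (simp add: upt_conv_Cons map_Suc_upt[symmetric] o_def del: upt_Suc)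
  then show ?case
    using Cons[of "\<lambda>c. v (3 * c)"] by (simp add: eval_row_radd eval_row_rscale mult.commute)
qed simp

text \<open>Entry \<open>k\<close> is what remains of the product for \<open>W(J) = 3 ^ k\<close>
  after the factor \<open>W(J) - 1\<close> is split off; \<open>k\<close> runs from 0 to the
  dimension 10.\<close>

definition gauss_weights :: "nat \<Rightarrow> int list" where
  "gauss_weights r = map (\<lambda>k. prod_list (map (\<lambda>i. 3 ^ k - 3 ^ Suc i) [0..<r])) [0..<11]"

text \<open>Passes from the number \<open>n\<close> of common zeros to the weight
  \<open>e - n\<close>; \<open>reversed\<close> is the same operation on polynomials.\<close>

fun reflect :: "nat \<Rightarrow> int list \<Rightarrow> int poly" where
  "reflect e [] = 0" | "reflect e (a # q) = monom a e + reflect (e - 1) q"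

definition reversed :: "nat \<Rightarrow> int poly \<Rightarrow> int poly" where
  "reversed e p = (\<Sum>n\<le>e. monom (coeff p n) (e - n))"

lemma reversed_add: "reversed e (p + q) = reversed e p + reversed e q"
  by (simp add: reversed_def sum.distrib add_monom[symmetric])

lemma reversed_sum: "reversed e (\<Sum>x\<in>A. F x) = (\<Sum>x\<in>A. reversed e (F x))"
  by (induction A rule: infinite_finite_induct) (auto simp: reversed_add, simp_all add: reversed_def)

lemma reversed_monom: "n \<le> e \<Longrightarrow> reversed e (monom c n) = monom c (e - n)"
  by (simp add: reversed_def if_distrib[of "\<lambda>c. monom c _"] cong: if_cong)

lemma reversed_shift: "reversed (Suc e) (monom 1 1 * p) = reversed e p"
  unfolding reversed_def
  by (subst sum.atMost_Suc_shift) (simp add: coeff_monom_mult)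

lemma reversed_eval_row:
  "length q \<le> Suc e \<Longrightarrow> reversed e (eval_row (monom 1 1) q) = reflect e q"
proof (induction q arbitrary: e)
  case Nil
  then show ?case by (simp add: reversed_def)
next
  case (Cons a q)
  have a: "reversed e (of_int a) = monom a e" for e
    using reversed_monom[of 0 e a] by (simp add: monom_0 of_int_poly)
  show ?case
  proof (cases e)
    case 0
    then show ?thesis
      using Cons.prems a by simp
  next
    case (Suc e')
    then show ?thesis
      using Cons reversed_shift[of e' "eval_row (monom 1 1) q"] by (simp add: reversed_add a)
  qed
qed

text \<open>The order of the general linear group, that is, the number of ordered bases of an
  \<open>r\<close>-dimensional space.\<close>

definition gauss_order :: "nat \<Rightarrow> int" where
  "gauss_order r = prod_list (map (\<lambda>i. 3 ^ r - 3 ^ i) [0..<r])"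

lemma prod_list_upt: "prod_list (map F [0..<n]) = (\<Prod>i<n. F i)"
  using prod.distinct_set_conv_list[of "[0..<n]" F] by (simp add: atLeast0LessThan)

lemma gauss_order_nonzero: "gauss_order r \<noteq> 0"
  by (auto simp: gauss_order_def prod_list_upt)

section \<open>Sums over subsets of the zero set for the six classes of forms\<close>

definition double_plane_poly :: bipoly where
  "double_plane_poly =
    [[], [], [], [], [324, - 1560, 2808, - 2106, 260, 351, 0, - 78, 0, 0, 0, 0, 0, 1], [- 702,
    3120, - 5148, 3510, - 390, - 468, 0, 78], [585, - 2223, 3042, - 1638, 117, 117], [- 273,
    806, - 780, 234, 13], [78, - 156, 78], [- 13, 13], [1]]"

text \<open>Row \<open>k\<close> is the sum of \<open>(z - 1) ^ card J\<close> over the sets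
  \<open>J\<close> of zeros with \<open>W(J) = 3 ^ k\<close>. For \<open>x0 * x0\<close> the rows
  below 4 are empty, because the forms that vanish on the whole plane are \<open>x0\<close> times a
  linear form.\<close>

lemma steps_double_plane:
  "steps 10 (put (zero_forms [Tz, Tz, Tz, Tz, Tz, Tz, Tz, Tz, Tz, Tp]) [[1]] Lf)
    = Nd Lf [] double_plane_poly Lf"
  by code_simp

definition plane_pair_poly :: bipoly where
  "plane_pair_poly =
    [[], [- 30618, 226224, - 704376, 1178064, - 1097474, 499068, - 30375, - 38064, - 13446,
    9720, 1800, 0, - 486, - 68, 54, 0, - 24, 0, 0, 0, 0, 0, 1], [76788, - 537840, 1580688, -
    2480544, 2146830, - 884124, 27216, 62976, 23760, - 13608, - 2664, 0, 486, 84, - 72, 0, 24],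
    [- 80514, 516240, - 1373760, 1921644, - 1443456, 480690, 15390, - 28620, - 12366, 3888,
    864, 0, 0, - 18, 18], [50868, - 288456, 665064, - 781164, 464920, - 101898, - 14904, 3516,
    2052, 0, 0, 0, 0, 2], [- 22059, 106662, - 202617, 185220, - 75885, 5814, 2673, 192], [6840,
    - 26910, 39240, - 24660, 5040, 450], [- 1515, 4520, - 4470, 1440, 25], [231, - 462, 231],
    [- 22, 22], [1]]"

text \<open>The two planes of \<open>x0 * x1\<close> meet in a line, which gives 13 + 13 - 4 = 22
  points.\<close>

lemma steps_plane_pair:
  "steps 10 (put (zero_forms [Tp, Tz, Tz, Tz, Tz, Tz, Tz, Tz, Tz, Tz]) [[1]] Lf)
    = Nd Lf [] plane_pair_poly Lf"
  by code_simp

definition line_poly :: bipoly where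
  "line_poly =
    [[], [], [], [], [], [], [], [- 3, 8, - 6, 0, 1], [6, - 12, 6], [- 4, 4], [1]]"

text \<open>The zeros of \<open>x0 * x0 + x1 * x1\<close> are the four points of a line. Any three
  impose independent conditions and imply the fourth, so row 7 is
  \<open>4 * (z - 1) ^ 3 + (z - 1) ^ 4\<close>.\<close>

lemma steps_line:
  "steps 10 (put (zero_forms [Tz, Tp, Tz, Tz, Tz, Tz, Tz, Tz, Tz, Tp]) [[1]] Lf)
    = Nd Lf [] line_poly Lf"
  by code_simp

definition cone_poly :: bipoly where
  "cone_poly =
    [[], [], [297, - 2132, 6480, - 10692, 10094, - 5103, 972, 60, 81, - 54, - 4, 0, 0, 1], [-
    891, 5864, - 16182, 23922, - 19824, 8442, - 1134, - 138, - 117, 54, 4], [1242, - 7164,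
    16938, - 20736, 13410, - 3852, 54, 72, 36], [- 1107, 5397, - 10386, 9720, - 4215, 477, 108,
    6], [675, - 2664, 3906, - 2484, 531, 36], [- 282, 842, - 834, 270, 4], [78, - 156, 78], [-
    13, 13], [1]]"

text \<open>The representative is \<open>x0 * x1 + x2 * x2\<close>. The forms that vanish on all 13
  points come from the pencil of conics through four points, so row 2 is the first nonempty
  one.\<close>

lemma steps_cone:
  "steps 10 (put (zero_forms [Tp, Tz, Tz, Tz, Tz, Tp, Tz, Tz, Tz, Tz]) [[1]] Lf)
    = Nd Lf [] cone_poly Lf"
  by code_simp

definition hyperbolic_poly :: bipoly where
  "hyperbolic_poly =
    [[], [- 1071, 8256, - 27072, 48384, - 49476, 26496, - 4032, - 1792, - 234, 576, 0, 0, - 36,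
    0, 0, 0, 1], [3780, - 27168, 82512, - 135360, 125244, - 58752, 6048, 4032, 540, - 864, -
    48, 0, 36], [- 5982, 38976, - 105960, 152832, - 120708, 45024, - 1176, - 2880, - 462, 288,
    48], [5748, - 32928, 77016, - 92496, 57360, - 14208, - 1272, 624, 156], [- 3744, 18208, -
    34896, 32400, - 13760, 1344, 432, 16], [1716, - 6768, 9912, - 6288, 1332, 96], [- 552,
    1648, - 1632, 528, 8], [120, - 240, 120], [- 16, 16], [1]]"

text \<open>The representative is \<open>x0 * x1 + x2 * x2 - x3 * x3\<close>, with 16
  points.\<close>

lemma steps_hyperbolic:
  "steps 10 (put (zero_forms [Tp, Tz, Tz, Tz, Tz, Tp, Tn, Tz, Tz, Tz]) [[1]] Lf)
    = Nd Lf [] hyperbolic_poly Lf"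
  by code_simp

definition elliptic_poly :: bipoly where
  "elliptic_poly =
    [[], [- 9, 80, - 315, 720, - 1050, 1008, - 630, 240, - 45, 0, 1], [45, - 360, 1260, - 2520,
    3150, - 2520, 1260, - 360, 45], [- 120, 840, - 2520, 4200, - 4200, 2520, - 840, 120], [210,
    - 1260, 3150, - 4200, 3150, - 1260, 210], [- 252, 1260, - 2520, 2520, - 1260, 252], [210, -
    840, 1260, - 840, 210], [- 120, 360, - 360, 120], [45, - 90, 45], [- 10, 10], [1]]"

text \<open>The representative \<open>x0 * x0 + x1 * x1 + x2 * x2 - x3 * x3\<close> has ten points,
  any nine of which impose independent conditions. Row \<open>k\<close> is thus binomial for
  \<open>k\<close> at least 2, and row 1 is \<open>10 * (z - 1) ^ 9 + (z - 1) ^ 10\<close>.\<close>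

lemma steps_elliptic:
  "steps 10 (put (zero_forms [Tz, Tp, Tz, Tz, Tz, Tp, Tn, Tz, Tz, Tp]) [[1]] Lf)
    = Nd Lf [] elliptic_poly Lf"
  by code_simp

definition total_poly :: bipoly where
  "total_poly = badd (bscale 80 double_plane_poly)
    (badd (bscale 1560 plane_pair_poly)
    (badd (bscale 780 line_poly)
    (badd (bscale 18720 cone_poly)
    (badd (bscale 21060 hyperbolic_poly)
    (bscale 16848 elliptic_poly)))))"

lemma length_total_poly: "length total_poly = 11"
  by code_simp

context ternary
begin

text \<open>Removing the zero form cancels the term \<open>diag w z 0 0 0 0\<close> of
  \<open>sum_diag\<close>.\<close>

lemma sum_Psi_nonzero:
  "(\<Sum>f\<in>kspace 10 - {replicate 10 0}. point_sum w z (quadric_zeros (f :: 'k list))) = eval_bipoly z total_poly (\<lambda>w. w 1) w"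
proof -
  \<comment> \<open>Where the entries start with \<open>1\<close>, \<open>- 1\<close>, the evaluated
    representative contains \<open>x0 * x1\<close>, so \<open>quad_sum_split0\<close> is used
    backwards.\<close>
  have d: "diag w z 1 0 0 0 = point_sum w z (quadric_zeros (map tk [Tz, Tz, Tz, Tz, Tz, Tz, Tz, Tz, Tz, Tp] :: 'k list))"
    "diag w z 1 (- 1) 0 0 = point_sum w z (quadric_zeros (map tk [Tp, Tz, Tz, Tz, Tz, Tz, Tz, Tz, Tz, Tz] :: 'k list))"
    "diag w z 1 1 0 0 = point_sum w z (quadric_zeros (map tk [Tz, Tp, Tz, Tz, Tz, Tz, Tz, Tz, Tz, Tp] :: 'k list))"
    "diag w z 1 (- 1) 1 0 = point_sum w z (quadric_zeros (map tk [Tp, Tz, Tz, Tz, Tz, Tp, Tz, Tz, Tz, Tz] :: 'k list))"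
    "diag w z 1 (- 1) 1 (- 1) = point_sum w z (quadric_zeros (map tk [Tp, Tz, Tz, Tz, Tz, Tp, Tn, Tz, Tz, Tz] :: 'k list))"
    "diag w z 1 1 1 (- 1) = point_sum w z (quadric_zeros (map tk [Tz, Tp, Tz, Tz, Tz, Tp, Tn, Tz, Tz, Tp] :: 'k list))"
    by (simp_all only: diag_def quad_sum_split0[symmetric], simp_all add: quad_sum_def)
  have "replicate 10 0 \<in> (kspace 10 :: 'k list set)"
    by (simp add: kspace_def)
  then have "(\<Sum>f\<in>kspace 10. point_sum w z (quadric_zeros (f :: 'k list)))
      = point_sum w z (quadric_zeros (replicate 10 (0 :: 'k))) + (\<Sum>f\<in>kspace 10 - {replicate 10 0}. point_sum w z (quadric_zeros (f :: 'k list)))"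
    by (simp add: sum.remove)
  moreover have "diag w z 0 0 0 0 = point_sum w z (quadric_zeros (replicate 10 (0 :: 'k)))"
    by (simp add: diag_def quad_sum_def eval_nat_numeral)
  ultimately have "(\<Sum>f\<in>kspace 10 - {replicate 10 0}. point_sum w z (quadric_zeros (f :: 'k list)))
     = 80 * diag w z 1 0 0 0 + 1560 * diag w z 1 (- 1) 0 0 + 780 * diag w z 1 1 0 0
     + 18720 * diag w z 1 (- 1) 1 0 + 21060 * diag w z 1 (- 1) 1 (- 1) + 16848 * diag w z 1 1 1 (- 1)"
    using sum_diag[of w z] by (simp add: add.assoc)
  also have "\<dots> = eval_bipoly z total_poly (\<lambda>w. w 1) w"
    unfolding d point_sum_quadric_zeros[OF steps_double_plane] point_sum_quadric_zeros[OF steps_plane_pair] point_sum_quadric_zeros[OF steps_line]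
      point_sum_quadric_zeros[OF steps_cone] point_sum_quadric_zeros[OF steps_hyperbolic] point_sum_quadric_zeros[OF steps_elliptic]
    by (simp add: total_poly_def eval_bipoly_badd eval_bipoly_bscale add.assoc)
  finally show ?thesis .
qed

text \<open>The list \<open>q\<close> enumerates subcodes by their number of common zeros. The
  computation yields its multiple by \<open>gauss_order n\<close>, and this nonzero factor is
  cancelled at the end, so that no division is carried out.\<close>

lemma gen_weight_enum_veronese:
  fixes P :: "40 \<Rightarrow> ('k ^ 4) set" and G :: "'k ^ 40 ^ 10"
  assumes PG: "bij_betw P UNIV proj_points" "is_veronese_matrix P G"
    and "rscale (gauss_order n) q = lincomb (gauss_weights r) total_poly" "length q \<le> 41" "n = Suc r"
  shows "gen_weight_enum n (generated_code G) = reflect 40 q"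
proof -
  note q = assms(3,4)[unfolded \<open>n = Suc r\<close>]
  let ?z = "monom 1 1 :: int poly"
  let ?N = "\<Sum>D\<in>subcodes (Suc r) (generated_code G). ?z ^ card (zeros D)"
  have w: "gauss_weights r = map (\<lambda>k. \<Prod>i<r. int (3 ^ k) - 3 ^ Suc i) [0..<length total_poly]"
    by (simp add: gauss_weights_def prod_list_upt length_total_poly del: upt_Suc)
  have "of_int (gauss_order (Suc r)) * ?N = eval_bipoly ?z total_poly (\<lambda>w. w 1) (\<lambda>c. of_int (\<Prod>i<r. int c - 3 ^ Suc i))"
    unfolding sum_Psi_nonzero[symmetric] veronese_subcode_enumerator[OF PG, symmetric]
      gauss_order_def prod_list_upt ..
  also have "\<dots> = of_int (gauss_order (Suc r)) * eval_row ?z q"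
    unfolding eval_bipoly_lincomb w[symmetric] q(1)[symmetric] eval_row_rscale ..
  finally have N: "?N = eval_row ?z q"
    using gauss_order_nonzero[of "Suc r"] by simp
  have "gen_weight_enum (Suc r) (generated_code G)
      = (\<Sum>D\<in>subcodes (Suc r) (generated_code G). reversed 40 (?z ^ card (zeros D)))"
    unfolding gen_weight_enum_def
  proof (rule sum.cong)
    fix D :: "('k ^ 40) set"
    have "card (zeros D) \<le> 40"
      using card_mono[of UNIV "zeros D"] by simp
    then show "monom 1 (card (code_supp D)) = reversed 40 (?z ^ card (zeros D))"
      by (simp add: monom_power reversed_monom card_code_supp)
  qed simp
  also have "\<dots> = reflect 40 q"
    unfolding reversed_sum[symmetric] N by (rule reversed_eval_row) (use q(2) in simp)
  finally show ?thesis
    by (simp only: \<open>n = Suc r\<close>)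
qed

text \<open>The coefficients count subcodes, so contributions cannot cancel and the least weight is
  the lowest exponent that occurs.\<close>

lemma gen_hamming_weight_eq:
  fixes C :: "('k ^ 'n) set"
  assumes "gen_weight_enum r C = monom 1 1 ^ d * q" and q: "poly q 0 \<noteq> 0"
  shows "gen_hamming_weight r C = d"
proof -
  have W: "gen_weight_enum r C = monom 1 d * q"
    by (simp add: assms monom_power)
  have fin: "finite (subcodes r C)"
    by (rule finite_vec_sets)
  have coeff: "coeff (gen_weight_enum r C) i = (\<Sum>D\<in>subcodes r C. if card (code_supp D) = i then 1 else 0)" for i
    by (simp add: gen_weight_enum_def coeff_sum)
  show ?thesis
    unfolding gen_hamming_weight_def
  proof (rule Min_eqI)
    show "finite ((\<lambda>D. card (code_supp D)) ` subcodes r C)"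
      using fin by simp
  next
    fix i assume "i \<in> (\<lambda>D. card (code_supp D)) ` subcodes r C"
    then obtain D where D: "D \<in> subcodes r C" "card (code_supp D) = i"
      by auto
    have "coeff (gen_weight_enum r C) i > 0"
      unfolding coeff by (rule sum_pos2[OF fin D(1)]) (simp_all add: D)
    then show "d \<le> i"
      by (rule contrapos_pp) (simp add: W coeff_monom_mult)
  next
    have nz: "coeff (gen_weight_enum r C) d \<noteq> 0"
      using q by (simp add: W coeff_monom_mult poly_0_coeff_0)
    show "d \<in> (\<lambda>D. card (code_supp D)) ` subcodes r C"
    proof (rule ccontr)
      assume "d \<notin> (\<lambda>D. card (code_supp D)) ` subcodes r C"
      then have "coeff (gen_weight_enum r C) d = 0"
        unfolding coeff by (intro sum.neutral) auto
      with nz show False ..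
    qed
  qed
qed

end

section \<open>Numbers of subcodes by dimension and number of common zeros\<close>

definition counts1 :: "int list" where
  "counts1 =
    [0, 0, 0, 0, 390, 0, 0, 0, 0, 0, 8424, 0, 0, 9400, 0, 0, 10530, 0, 0, 0, 0, 0, 780]"

text \<open>The equation compares lists literally, so \<open>counts1\<close> and the later lists
  extend to index 22, the largest number of zeros of a nonzero form, attained by a pair of
  planes.\<close>

lemma counts1_correct: "rscale (gauss_order 1) counts1 = lincomb (gauss_weights 0) total_poly"
  by code_simp

definition counts2 :: "int list" where
  "counts2 =
    [881361, 3159000, 7771140, 12130560, 14970930, 12888720, 10614240, 5569200, 2369250,
    1516320, 561600, 0, 189540, 9880, 0, 0, 4680, 0, 0, 0, 0, 0, 0]"

lemma counts2_correct: "rscale (gauss_order 2) counts2 = lincomb (gauss_weights 1) total_poly"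
  by code_simp

definition counts3 :: "int list" where
  "counts3 =
    [4081143690, 6153472080, 4714259940, 2309355360, 795119910, 208395720, 52313040, 9687600,
    2379780, 505440, 93600, 0, 0, 520, 1080, 0, 0, 0, 0, 0, 0, 0, 0]"

lemma counts3_correct: "rscale (gauss_order 3) counts3 = lincomb (gauss_weights 2) total_poly"
  by code_simp

definition counts4 :: "int list" where
  "counts4 =
    [304888261329, 152054622720, 37402159860, 5713746480, 641358900, 69893928, 7076160, 627120,
    89505, 0, 0, 0, 0, 40, 0, 0, 0, 0, 0, 0, 0, 0, 0]"

lemma counts4_correct: "rscale (gauss_order 4) counts4 = lincomb (gauss_weights 3) total_poly"
  by code_simp

definition counts5 :: "int list" where
  "counts5 =
    [1278145015290, 210588797640, 16880769360, 820076400, 35530690, 1912248, 63180, 3120, 0, 0,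
    0, 0, 0, 0, 0, 0, 0, 0, 0, 0, 0, 0, 0]"

lemma counts5_correct: "rscale (gauss_order 5) counts5 = lincomb (gauss_weights 4) total_poly"
  by code_simp

definition counts6 :: "int list" where
  "counts6 =
    [474327595872, 25772073720, 668039580, 9912240, 209950, 4680, 0, 0, 0, 0, 0, 0, 0, 0, 0, 0,
    0, 0, 0, 0, 0, 0, 0]"

lemma counts6_correct: "rscale (gauss_order 6) counts6 = lincomb (gauss_weights 5) total_poly"
  by code_simp

definition counts7 :: "int list" where
  "counts7 =
    [18006491610, 317697120, 2529540, 9360, 130, 0, 0, 0, 0, 0, 0, 0, 0, 0, 0, 0, 0, 0, 0, 0,
    0, 0, 0]"

lemma counts7_correct: "rscale (gauss_order 7) counts7 = lincomb (gauss_weights 6) total_poly"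
  by code_simp

definition counts8 :: "int list" where
  "counts8 =
    [72243561, 392080, 780, 0, 0, 0, 0, 0, 0, 0, 0, 0, 0, 0, 0, 0, 0, 0, 0, 0, 0, 0, 0]"

lemma counts8_correct: "rscale (gauss_order 8) counts8 = lincomb (gauss_weights 7) total_poly"
  by code_simp

definition counts9 :: "int list" where
  "counts9 =
    [29484, 40, 0, 0, 0, 0, 0, 0, 0, 0, 0, 0, 0, 0, 0, 0, 0, 0, 0, 0, 0, 0, 0]"

lemma counts9_correct: "rscale (gauss_order 9) counts9 = lincomb (gauss_weights 8) total_poly"
  by code_simp

definition counts10 :: "int list" where
  "counts10 =
    [1, 0, 0, 0, 0, 0, 0, 0, 0, 0, 0, 0, 0, 0, 0, 0, 0, 0, 0, 0, 0, 0, 0]"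

lemma counts10_correct: "rscale (gauss_order 10) counts10 = lincomb (gauss_weights 9) total_poly"
  by code_simp

theorem theorem1p2:
  fixes P :: "40 \<Rightarrow> ('k::field ^ 4) set"
    and G :: "'k ^ 40 ^ 10"
    and C :: "('k ^ 40) set"
    and Z :: "int poly"
  assumes "CARD('k) = 3"
    and "bij_betw P UNIV proj_points"
    and "is_veronese_matrix P G"
    and "C = generated_code G"
    and "Z = monom 1 1"
  shows "vec.dim C = 10
    \<and> gen_weight_enum 1 C = 2 * Z^18 * (195 * Z^18 + 4212 * Z^12 + 4700 * Z^9 + 5265 * Z^6 + 390)
    \<and> gen_weight_enum 2 C = 13 * Z^24 * (67797 * Z^16 + 243000 * Z^15 + 597780 * Z^14
        + 933120 * Z^13 + 1151610 * Z^12 + 991440 * Z^11 + 816480 * Z^10 + 428400 * Z^9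
        + 182250 * Z^8 + 116640 * Z^7 + 43200 * Z^6 + 14580 * Z^4 + 760 * Z^3 + 360)
    \<and> gen_weight_enum 3 C = 10 * Z^26 * (408114369 * Z^14 + 615347208 * Z^13 + 471425994 * Z^12
        + 230935536 * Z^11 + 79511991 * Z^10 + 20839572 * Z^9 + 5231304 * Z^8 + 968760 * Z^7
        + 237978 * Z^6 + 50544 * Z^5 + 9360 * Z^4 + 52 * Z + 108)
    \<and> gen_weight_enum 4 C = Z^27 * (304888261329 * Z^13 + 152054622720 * Z^12
        + 37402159860 * Z^11 + 5713746480 * Z^10 + 641358900 * Z^9 + 69893928 * Z^8
        + 7076160 * Z^7 + 627120 * Z^6 + 89505 * Z^5 + 40)
    \<and> gen_weight_enum 5 C = 26 * Z^33 * (49159423665 * Z^7 + 8099569140 * Z^6 + 649260360 * Z^5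
        + 31541400 * Z^4 + 1366565 * Z^3 + 73548 * Z^2 + 2430 * Z + 120)
    \<and> gen_weight_enum 6 C = 2 * Z^35 * (237163797936 * Z^5 + 12886036860 * Z^4
        + 334019790 * Z^3 + 4956120 * Z^2 + 104975 * Z + 2340)
    \<and> gen_weight_enum 7 C = 10 * Z^36 * (1800649161 * Z^4 + 31769712 * Z^3 + 252954 * Z^2
        + 936 * Z + 13)
    \<and> gen_weight_enum 8 C = 13 * Z^38 * (5557197 * Z^2 + 30160 * Z + 60)
    \<and> gen_weight_enum 9 C = 4 * Z^39 * (7371 * Z + 10)
    \<and> gen_weight_enum 10 C = Z^40
    \<and> gen_hamming_weight 1 C = 18
    \<and> gen_hamming_weight 2 C = 24
    \<and> gen_hamming_weight 3 C = 26
    \<and> gen_hamming_weight 4 C = 27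
    \<and> gen_hamming_weight 5 C = 33
    \<and> gen_hamming_weight 6 C = 35
    \<and> gen_hamming_weight 7 C = 36
    \<and> gen_hamming_weight 8 C = 38
    \<and> gen_hamming_weight 9 C = 39
    \<and> gen_hamming_weight 10 C = 40"
proof -
  interpret ternary "TYPE('k)"
    by unfold_locales fact
  have refl: "reflect e (a # q) = of_int a * Z ^ e + reflect (e - 1) q" for e a q
    by (simp add: assms(5) monom_power of_int_poly smult_monom)
  \<comment> \<open>These rules multiply out the factored polynomials, to match the sum of monomials
    obtained from \<open>reflect\<close>.\<close>
  have collect: "Z ^ m * (numeral c * Z ^ n) = numeral c * Z ^ (m + n)"
    "Z ^ m * (numeral c * Z) = numeral c * Z ^ Suc m" "Z ^ m * numeral c = numeral c * Z ^ m" for m n c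
    by (simp_all add: power_add mult.left_commute mult.commute)
  note reflect_Z = refl reflect.simps(1)
  \<comment> \<open>The power of \<open>Z\<close> stands in front, the shape from which
    \<open>gen_hamming_weight_eq\<close> reads off the minimum; the factors are reordered at the
    very end.\<close>
  have W1: "gen_weight_enum 1 C = Z^18 * (2 * (195 * Z^18 + 4212 * Z^12 + 4700 * Z^9 + 5265 * Z^6 + 390))"
  proof -
    have "gen_weight_enum 1 C = reflect 40 counts1"
      unfolding assms(4)
      by (rule gen_weight_enum_veronese[OF assms(2,3) counts1_correct]) (simp_all add: counts1_def)
    then show ?thesis
      unfolding counts1_def reflect_Z by (simp add: distrib_left collect)
  qed
  have d1: "gen_hamming_weight 1 C = 18"
    by (rule gen_hamming_weight_eq[OF W1[unfolded assms(5)]]) (simp add: poly_monom)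
  have W2: "gen_weight_enum 2 C = Z^24 * (13 * (67797 * Z^16 + 243000 * Z^15 + 597780 * Z^14
      + 933120 * Z^13 + 1151610 * Z^12 + 991440 * Z^11 + 816480 * Z^10 + 428400 * Z^9
      + 182250 * Z^8 + 116640 * Z^7 + 43200 * Z^6 + 14580 * Z^4 + 760 * Z^3 + 360))"
  proof -
    have "gen_weight_enum 2 C = reflect 40 counts2"
      unfolding assms(4)
      by (rule gen_weight_enum_veronese[OF assms(2,3) counts2_correct]) (simp_all add: counts2_def)
    then show ?thesis
      unfolding counts2_def reflect_Z by (simp add: distrib_left collect)
  qed
  have d2: "gen_hamming_weight 2 C = 24"
    by (rule gen_hamming_weight_eq[OF W2[unfolded assms(5)]]) (simp add: poly_monom)
  have W3: "gen_weight_enum 3 C = Z^26 * (10 * (408114369 * Z^14 + 615347208 * Z^13 + 471425994 * Z^12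
      + 230935536 * Z^11 + 79511991 * Z^10 + 20839572 * Z^9 + 5231304 * Z^8 + 968760 * Z^7
      + 237978 * Z^6 + 50544 * Z^5 + 9360 * Z^4 + 52 * Z + 108))"
  proof -
    have "gen_weight_enum 3 C = reflect 40 counts3"
      unfolding assms(4)
      by (rule gen_weight_enum_veronese[OF assms(2,3) counts3_correct]) (simp_all add: counts3_def)
    then show ?thesis
      unfolding counts3_def reflect_Z by (simp add: distrib_left collect)
  qed
  have d3: "gen_hamming_weight 3 C = 26"
    by (rule gen_hamming_weight_eq[OF W3[unfolded assms(5)]]) (simp add: poly_monom)
  have W4: "gen_weight_enum 4 C = Z^27 * (304888261329 * Z^13 + 152054622720 * Z^12
      + 37402159860 * Z^11 + 5713746480 * Z^10 + 641358900 * Z^9 + 69893928 * Z^8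
      + 7076160 * Z^7 + 627120 * Z^6 + 89505 * Z^5 + 40)"
  proof -
    have "gen_weight_enum 4 C = reflect 40 counts4"
      unfolding assms(4)
      by (rule gen_weight_enum_veronese[OF assms(2,3) counts4_correct]) (simp_all add: counts4_def)
    then show ?thesis
      unfolding counts4_def reflect_Z by (simp add: distrib_left collect)
  qed
  have d4: "gen_hamming_weight 4 C = 27"
    by (rule gen_hamming_weight_eq[OF W4[unfolded assms(5)]]) (simp add: poly_monom)
  have W5: "gen_weight_enum 5 C = Z^33 * (26 * (49159423665 * Z^7 + 8099569140 * Z^6 + 649260360 * Z^5
      + 31541400 * Z^4 + 1366565 * Z^3 + 73548 * Z^2 + 2430 * Z + 120))"
  proof -
    have "gen_weight_enum 5 C = reflect 40 counts5"
      unfolding assms(4)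
      by (rule gen_weight_enum_veronese[OF assms(2,3) counts5_correct]) (simp_all add: counts5_def)
    then show ?thesis
      unfolding counts5_def reflect_Z by (simp add: distrib_left collect)
  qed
  have d5: "gen_hamming_weight 5 C = 33"
    by (rule gen_hamming_weight_eq[OF W5[unfolded assms(5)]]) (simp add: poly_monom)
  have W6: "gen_weight_enum 6 C = Z^35 * (2 * (237163797936 * Z^5 + 12886036860 * Z^4
      + 334019790 * Z^3 + 4956120 * Z^2 + 104975 * Z + 2340))"
  proof -
    have "gen_weight_enum 6 C = reflect 40 counts6"
      unfolding assms(4)
      by (rule gen_weight_enum_veronese[OF assms(2,3) counts6_correct]) (simp_all add: counts6_def)
    then show ?thesis
      unfolding counts6_def reflect_Z by (simp add: distrib_left collect)
  qed
  have d6: "gen_hamming_weight 6 C = 35"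
    by (rule gen_hamming_weight_eq[OF W6[unfolded assms(5)]]) (simp add: poly_monom)
  have W7: "gen_weight_enum 7 C = Z^36 * (10 * (1800649161 * Z^4 + 31769712 * Z^3 + 252954 * Z^2
      + 936 * Z + 13))"
  proof -
    have "gen_weight_enum 7 C = reflect 40 counts7"
      unfolding assms(4)
      by (rule gen_weight_enum_veronese[OF assms(2,3) counts7_correct]) (simp_all add: counts7_def)
    then show ?thesis
      unfolding counts7_def reflect_Z by (simp add: distrib_left collect)
  qed
  have d7: "gen_hamming_weight 7 C = 36"
    by (rule gen_hamming_weight_eq[OF W7[unfolded assms(5)]]) (simp add: poly_monom)
  have W8: "gen_weight_enum 8 C = Z^38 * (13 * (5557197 * Z^2 + 30160 * Z + 60))"
  proof -
    have "gen_weight_enum 8 C = reflect 40 counts8"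
      unfolding assms(4)
      by (rule gen_weight_enum_veronese[OF assms(2,3) counts8_correct]) (simp_all add: counts8_def)
    then show ?thesis
      unfolding counts8_def reflect_Z by (simp add: distrib_left collect)
  qed
  have d8: "gen_hamming_weight 8 C = 38"
    by (rule gen_hamming_weight_eq[OF W8[unfolded assms(5)]]) (simp add: poly_monom)
  have W9: "gen_weight_enum 9 C = Z^39 * (4 * (7371 * Z + 10))"
  proof -
    have "gen_weight_enum 9 C = reflect 40 counts9"
      unfolding assms(4)
      by (rule gen_weight_enum_veronese[OF assms(2,3) counts9_correct]) (simp_all add: counts9_def)
    then show ?thesis
      unfolding counts9_def reflect_Z by (simp add: distrib_left collect)
  qed
  have d9: "gen_hamming_weight 9 C = 39"
    by (rule gen_hamming_weight_eq[OF W9[unfolded assms(5)]]) (simp add: poly_monom)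
  have W10: "gen_weight_enum 10 C = Z^40 * (1)"
  proof -
    have "gen_weight_enum 10 C = reflect 40 counts10"
      unfolding assms(4)
      by (rule gen_weight_enum_veronese[OF assms(2,3) counts10_correct]) (simp_all add: counts10_def)
    then show ?thesis
      unfolding counts10_def reflect_Z by (simp add: distrib_left collect)
  qed
  have d10: "gen_hamming_weight 10 C = 40"
    by (rule gen_hamming_weight_eq[OF W10[unfolded assms(5)]]) (simp add: poly_monom)
  have "vec.dim C = 10"
    using dim_veronese_code[OF assms(2,3)] assms(4) by simp
  then show ?thesis
    by (simp only: W1 W2 W3 W4 W5 W6 W7 W8 W9 W10 d1 d2 d3 d4 d5 d6 d7 d8 d9 d10 mult.assoc
        mult.left_commute[of _ "Z ^ _"] mult_1_right simp_thms)
qed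

end
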